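(* Let $\Psi:\mathbb D\to\mathbb D$ be a map. The following conditions are equivalent: (i) $\Psi\in\mathcal K_{\mathrm c}$. (ii) $\Psi$ is a $\rho$-uniform homeomorphism of $\mathbb D$ with identity boundary values. (iii) $\Psi$ is a homeomorphism of $\mathbb D$ (onto itself) and $$\sup_{z\in\mathbb D}\rho(\Psi(z),z)<1,\qquad \lim_{t\downarrow0}\omega_\Psi(t)=0,\qquad \ell_\Psi(t)>0\quad(0<t<1).$$
   Context: $\mathbb D=\{z\in\mathbb C:|z|<1\}$, $\mathbb T=\partial\mathbb D$, and $\rho(z,w)=\left|\frac{z-w}{1-\overline z w}\right|$ is the pseudohyperbolic metric. The notation $A(z)\asymp B(z)$ means that there are constants $0<c\le C<\infty$, independent of $z$ (possibly depending on the map), with $cB\le A\le CB$. Sequences are indexed families $\Lambda=(\lambda_j)$ (finite or countably infinite) of points of $\mathbb D$; the image $\Phi(\Lambda)=(\Phi(\lambda_j))$ retains repeated terms. $\mathcal C$ denotes the class of Carleson (interpolating) sequences: $\Lambda=(\lambda_j)\in\mathcal C$ if every bounded scalar sequence $(a_j)$ is of the form $a_j=f(\lambda_j)$ for some $f\in H^\infty(\mathbb D)$. Finite sequences of distinct points belong to $\mathcal C$; a sequence with a repeated term does not. $\mathcal C_{\leftrightarrow}^{\mathrm c}$ is the class of continuous maps $\Phi:\mathbb D\to\mathbb D$ such that for every indexed sequence $\Lambda\subset\mathbb D$, $\Lambda\in\mathcal C\Leftrightarrow\Phi(\Lambda)\in\mathcal C$. $\mathcal P_{\mathrm c}=\{\Phi\in\mathcal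 C_{\leftrightarrow}^{\mathrm c}:1-|\Phi(z)|^2\asymp1-|z|^2\text{ for }z\in\mathbb D\}$. A homeomorphism $F$ of $\mathbb D$ onto itself is a $\rho$-uniform homeomorphism if both $F$ and $F^{-1}$ are uniformly continuous with respect to $\rho$. Every such $F$ extends uniquely to a homeomorphism of $\overline{\mathbb D}$; its restriction to $\mathbb T$ is the boundary map $h_F$. "Identity boundary values" means that the continuous extension to $\overline{\mathbb D}$ restricts to $\operatorname{id}_{\mathbb T}$ on $\mathbb T$. Every map in $\mathcal P_{\mathrm c}$ is a $\rho$-uniform homeomorphism of $\mathbb D$, and $\mathcal K_{\mathrm c}=\{\Psi\in\mathcal P_{\mathrm c}:h_\Psi=\operatorname{id}_{\mathbb T}\}$. For a homeomorphism $\Psi$ of $\mathbb D$ and $0<t<1$: $\omega_\Psi(t)=\sup\{\rho(\Psi(z),\Psi(w)):z,w\in\mathbb D,\ \rho(z,w)\le t\}$ and $\ell_\Psi(t)=\inf\{\rho(\Psi(z),\Psi(w)):z,w\in\mathbb D,\ \rho(z,w)\ge t\}$. *)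

theory Defs
  imports "HOL-Complex_Analysis.Complex_Analysis"
begin

abbreviation unit_disc :: "complex set" where
  "unit_disc \<equiv> ball 0 1"

abbreviation unit_circle :: "complex set" where
  "unit_circle \<equiv> sphere 0 1"

section \<open>The pseudohyperbolic metric\<close>

definition rho :: "complex \<Rightarrow> complex \<Rightarrow> real" where
  "rho z w = cmod ((z - w) / (1 - cnj z * w))"

lemma one_minus_cnj_mult_nonzero:
  assumes "cmod z < 1" "cmod w < 1"
  shows "1 - cnj z * w \<noteq> 0"
proof
  assume "1 - cnj z * w = 0"
  then have "cmod (cnj z * w) = 1" by (metis eq_iff_diff_eq_0 norm_one)
  moreover have "cmod (cnj z * w) < 1"
    using norm_mult_less[of "cnj z" 1 w 1] assms by simp
  ultimately show False by simp
qed

lemma cmod_one_minus_commute: "cmod (1 - cnj z * w) = cmod (1 - cnj w * z)"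
proof -
  have "cnj (1 - cnj z * w) = 1 - cnj w * z" by simp
  then show ?thesis by (metis complex_mod_cnj)
qed

lemma rho_commute: "rho z w = rho w z"
  by (simp add: rho_def norm_divide norm_minus_commute[of z w] cmod_one_minus_commute[of z w])

lemma cmod_diff_square:
  "(cmod (a - b))\<^sup>2 = (cmod (1 - cnj a * b))\<^sup>2 - (1 - (cmod a)\<^sup>2) * (1 - (cmod b)\<^sup>2)"
  unfolding cmod_power2 by (simp add: algebra_simps power2_eq_square)

lemma rho_le_sum_cmod:
  assumes "cmod a < 1" "cmod b < 1"
  shows "rho a b \<le> cmod a + cmod b"
proof -
  let ?A = "cmod a" and ?B = "cmod b" and ?s = "cmod (1 - cnj a * b)"
  have nz: "?s > 0" using one_minus_cnj_mult_nonzero[OF assms] by simp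
  have s: "?s \<le> 1 + ?A * ?B"
    using norm_triangle_ineq4[of 1 "cnj a * b"] by (simp add: norm_mult)
  have "(cmod (a - b))\<^sup>2 \<le> ((?A + ?B) * ?s)\<^sup>2"
  proof (cases "?A + ?B \<ge> 1")
    case True
    have "0 \<le> (1 - ?A\<^sup>2) * (1 - ?B\<^sup>2)"
      using assms by (intro mult_nonneg_nonneg) (auto simp: abs_square_le_1)
    then have "(cmod (a - b))\<^sup>2 \<le> ?s\<^sup>2" using cmod_diff_square[of a b] by linarith
    also have "\<dots> \<le> ((?A + ?B) * ?s)\<^sup>2"
      using True nz by (intro power_mono) auto
    finally show ?thesis .
  next
    case False
    have "?s\<^sup>2 * (1 - (?A + ?B)\<^sup>2) \<le> (1 + ?A * ?B)\<^sup>2 * (1 - (?A + ?B)\<^sup>2)"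
      using False s nz by (intro mult_right_mono power_mono) (auto simp: abs_square_le_1)
    also have "\<dots> = (1 - ?A\<^sup>2) * (1 - ?B\<^sup>2) - (?A + ?B)\<^sup>2 * ((1 + ?A * ?B)\<^sup>2 - 1)"
      by (simp add: algebra_simps power2_eq_square)
    also have "\<dots> \<le> (1 - ?A\<^sup>2) * (1 - ?B\<^sup>2)"
      by simp
    finally have "?s\<^sup>2 - (1 - ?A\<^sup>2) * (1 - ?B\<^sup>2) \<le> (?A + ?B)\<^sup>2 * ?s\<^sup>2"
      by (simp add: algebra_simps)
    then show ?thesis unfolding power_mult_distrib using cmod_diff_square[of a b] by linarith
  qed
  then have "cmod (a - b) \<le> (?A + ?B) * ?s"
    by (rule power2_le_imp_le) (intro mult_nonneg_nonneg add_nonneg_nonneg norm_ge_zero)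
  then show ?thesis
    unfolding rho_def norm_divide using nz by (simp only: pos_divide_le_eq)
qed

lemma rho_lt_1:
  assumes "cmod z < 1" "cmod w < 1"
  shows "rho z w < 1"
  using Moebius_function_norm_lt_1[OF assms, of 0]
  by (simp add: Moebius_function_simple rho_def norm_divide norm_minus_commute)

lemma rho_triangle:
  assumes x: "cmod x < 1" and y: "cmod y < 1" and z: "cmod z < 1"
  shows "rho x z \<le> rho x y + rho y z"
proof -
  define a where "a = (x - y) / (1 - cnj y * x)"
  define b where "b = (z - y) / (1 - cnj y * z)"
  have a: "cmod a = rho y x" and b: "cmod b = rho y z"
    by (simp_all add: a_def b_def rho_def norm_divide norm_minus_commute)
  have lt: "cmod a < 1" "cmod b < 1" using a b rho_lt_1 x y z by auto
  have n: "1 - cnj y * x \<noteq> 0" "1 - cnj y * z \<noteq> 0" "1 - cnj x * y \<noteq> 0" "1 - cnj y * y \<noteq> 0"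
    using one_minus_cnj_mult_nonzero x y z by blast+
  have d: "a - b = (1 - cnj y * y) * (x - z) / ((1 - cnj y * x) * (1 - cnj y * z))"
  proof -
    have "(x - y) * (1 - cnj y * z) - (z - y) * (1 - cnj y * x) = (1 - cnj y * y) * (x - z)"
      by (simp add: algebra_simps)
    then show ?thesis unfolding a_def b_def diff_frac_eq[OF n(1,2)] by (simp only:)
  qed
  have ca: "cnj a = (cnj x - cnj y) / (1 - cnj x * y)"
    by (simp add: a_def mult.commute)
  have e: "1 - cnj a * b = (1 - cnj y * y) * (1 - cnj x * z) / ((1 - cnj x * y) * (1 - cnj y * z))"
  proof -
    have "(1 - cnj x * y) * (1 - cnj y * z) - (cnj x - cnj y) * (z - y) =
      (1 - cnj y * y) * (1 - cnj x * z)"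
      by (simp add: algebra_simps)
    moreover have "1 - cnj a * b =
      ((1 - cnj x * y) * (1 - cnj y * z) - (cnj x - cnj y) * (z - y)) / ((1 - cnj x * y) * (1 - cnj y * z))"
    proof -
      have "1 - u / v = (v - u) / v" if "v \<noteq> 0" for u v :: complex
        using that by (simp add: diff_divide_distrib)
      moreover have "(1 - cnj x * y) * (1 - cnj y * z) \<noteq> 0"
        using n(2,3) by (simp only: mult_eq_0_iff simp_thms)
      ultimately show ?thesis unfolding ca b_def times_divide_times_eq by blast
    qed
    ultimately show ?thesis by (simp only:)
  qed
  have "rho a b = rho x z"
  proof -
    have "(k * m / (p * q)) / (k * r / (p * q)) = m / r" if "k \<noteq> 0" "p \<noteq> 0" "q \<noteq> 0"
      for k m p q r :: real
      using that by simp
    moreover have "cmod (1 - cnj y * y) \<noteq> 0" "cmod (1 - cnj y * x) \<noteq> 0" "cmod (1 - cnj y * z) \<noteq> 0"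
      using n by (simp_all only: norm_eq_zero not_False_eq_True)
    ultimately show ?thesis
      unfolding rho_def norm_divide d e norm_mult cmod_one_minus_commute[of x y] by blast
  qed
  then show ?thesis
    using rho_le_sum_cmod[OF lt] unfolding a b rho_commute[of y x] by (simp only:)
qed

interpretation pseudohyperbolic: Metric_space unit_disc rho
proof
  show "0 \<le> rho x y" for x y by (simp add: rho_def)
  show "rho x y = rho y x" for x y by (rule rho_commute)
  show "rho x y = 0 \<longleftrightarrow> x = y" if "x \<in> unit_disc" "y \<in> unit_disc" for x y
    using that one_minus_cnj_mult_nonzero[of x y] by (simp add: rho_def)
  show "rho x z \<le> rho x y + rho y z"
    if "x \<in> unit_disc" "y \<in> unit_disc" "z \<in> unit_disc" for x y z
    using that rho_triangle by simp
qed

abbreviation rho_metric :: "complex metric" where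
  "rho_metric \<equiv> metric (unit_disc, rho)"

section \<open>Interpolating sequences\<close>

definition H_infinity :: "(complex \<Rightarrow> complex) set" where
  "H_infinity = {f. f holomorphic_on unit_disc \<and> bounded (f ` unit_disc)}"

text \<open>
  A finite or countably infinite indexed family is a function on an arbitrary index
  set \<open>I\<close> of natural numbers; its values outside \<open>I\<close> are irrelevant, and repeated terms are allowed.
\<close>

definition carleson_sequence :: "nat set \<Rightarrow> (nat \<Rightarrow> complex) \<Rightarrow> bool" where
  "carleson_sequence I \<Lambda> \<longleftrightarrow>
     \<Lambda> \<in> I \<rightarrow> unit_disc \<and>
     (\<forall>a :: nat \<Rightarrow> complex. bounded (a ` I) \<longrightarrow> (\<exists>f\<in>H_infinity. \<forall>j\<in>I. f (\<Lambda> j) = a j))"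

section \<open>Classes of self-maps of the disc\<close>

text \<open>
  Self-maps of the disc are represented by functions on the whole plane; every notion below
  depends only on their values on the disc.
\<close>

definition carleson_equivalence_maps :: "(complex \<Rightarrow> complex) set" where
  "carleson_equivalence_maps =
     {\<Phi>. \<Phi> \<in> unit_disc \<rightarrow> unit_disc \<and> continuous_on unit_disc \<Phi> \<and>
        (\<forall>I \<Lambda>. \<Lambda> \<in> I \<rightarrow> unit_disc \<longrightarrow>
           (carleson_sequence I \<Lambda> \<longleftrightarrow> carleson_sequence I (\<lambda>j. \<Phi> (\<Lambda> j))))}"

definition P_c :: "(complex \<Rightarrow> complex) set" where
  "P_c = {\<Phi> \<in> carleson_equivalence_maps.
     \<exists>c C. 0 < c \<and> c \<le> C \<and>
       (\<forall>z\<in>unit_disc. c * (1 - (cmod z)\<^sup>2) \<le> 1 - (cmod (\<Phi> z))\<^sup>2 \<and>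
                       1 - (cmod (\<Phi> z))\<^sup>2 \<le> C * (1 - (cmod z)\<^sup>2))}"

definition rho_uniform_homeomorphism :: "(complex \<Rightarrow> complex) \<Rightarrow> bool" where
  "rho_uniform_homeomorphism F \<longleftrightarrow>
     (\<exists>G. homeomorphism unit_disc unit_disc F G \<and>
          uniformly_continuous_map rho_metric rho_metric F \<and>
          uniformly_continuous_map rho_metric rho_metric G)"

text \<open>
  The boundary map of \<open>F\<close> is the restriction to the circle of the extension of \<open>F\<close> to a
  homeomorphism of the closed disc. Such an extension is unique, by density of the disc, so the
  boundary map is given here as a relation.
\<close>

definition is_boundary_map :: "(complex \<Rightarrow> complex) \<Rightarrow> (complex \<Rightarrow> complex) \<Rightarrow> bool" where
  "is_boundary_map F h \<longleftrightarrow>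
     (\<exists>E E'. homeomorphism (cball 0 1) (cball 0 1) E E' \<and>
        (\<forall>z\<in>unit_disc. E z = F z) \<and> (\<forall>\<zeta>\<in>unit_circle. E \<zeta> = h \<zeta>))"

definition identity_boundary_values :: "(complex \<Rightarrow> complex) \<Rightarrow> bool" where
  "identity_boundary_values F \<longleftrightarrow>
     (\<exists>E. continuous_on (cball 0 1) E \<and>
        (\<forall>z\<in>unit_disc. E z = F z) \<and> (\<forall>\<zeta>\<in>unit_circle. E \<zeta> = \<zeta>))"

definition K_c :: "(complex \<Rightarrow> complex) set" where
  "K_c = {\<Psi> \<in> P_c. is_boundary_map \<Psi> id}"

section \<open>Moduli of distortion\<close>

text \<open>
  For a self-map of the disc and \<open>0 < t < 1\<close> both sets below are nonempty and contained
  in \<open>{0..<1}\<close>, so the real supremum and infimum are meaningful.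
\<close>

definition omega :: "(complex \<Rightarrow> complex) \<Rightarrow> real \<Rightarrow> real" where
  "omega \<Psi> t = Sup {rho (\<Psi> z) (\<Psi> w) | z w. z \<in> unit_disc \<and> w \<in> unit_disc \<and> rho z w \<le> t}"

definition ell :: "(complex \<Rightarrow> complex) \<Rightarrow> real \<Rightarrow> real" where
  "ell \<Psi> t = Inf {rho (\<Psi> z) (\<Psi> w) | z w. z \<in> unit_disc \<and> w \<in> unit_disc \<and> rho z w \<ge> t}"

end

theory Submission
  imports Defs
begin

text \<open>
  Write \<open>closeness z w = 1 - (rho z w)\<^sup>2\<close>. It is comparable to \<open>exp (- d z w)\<close> for the hyperbolic distance
  \<open>d\<close> (scaled so that \<open>\<rho> = tanh (d / 2)\<close>) and satisfies a multiplicative triangle inequality up to a factor 4, so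
  that "\<open>\<rho>\<close> is bounded away from 1" becomes "closeness is bounded away from 0", a condition that can be chained.
  Everything turns on one quantity, the displacement bound \<open>\<eta> \<le> closeness (\<Psi> z) z\<close> for all \<open>z\<close>,
  which is the first part of (iii); the other two parts of (iii) are just the uniform
  continuity of \<open>\<Psi>\<close> and of its inverse (\<open>omega_tendsto_0_iff\<close>, \<open>ell_pos_iff\<close>).

  From (ii) to the displacement bound: a \<open>\<rho>\<close>-uniform homeomorphism is a quasi-isometry of the
  hyperbolic plane at large scale (\<open>closeness_image_ge\<close>), so it maps geodesics to quasigeodesics. If the image of
  a diameter has the same endpoints as the diameter, it must come within a bounded distance of the
  origin (\<open>diameter_image_meets_compact\<close>, a form of the Morse lemma). Two perpendicular diameters then pin down the
  image of the origin, and Moebius conjugation, under which both the moduli of continuity and the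
  identity boundary values persist, moves any point to the origin (\<open>bounded_displacement\<close>).

  From the displacement bound to (i) and (ii): points of bounded hyperbolic displacement have Euclidean
  displacement tending to 0 at the circle, so \<open>\<Psi>\<close> and its inverse extend by the identity
  (\<open>continuous_on_extend_by_id\<close>). The Carleson property is transferred by Carleson's interpolation theorem: a
  sequence is interpolating iff it is \<open>\<rho>\<close>-separated and its closeness sums
  \<open>\<Sum>j. closeness (\<Lambda> j) (\<Lambda> k)\<close> are bounded uniformly in \<open>k\<close> (\<open>carleson_sequence_iff_dispersed\<close>).
  Uniform continuity of the inverse keeps a sequence separated, and bounded displacement changes the
  closeness sums by at most a constant factor (\<open>carleson_sequence_image\<close>). The interpolation theorem is
  proved for finite sets with P. Jones's explicit interpolating functions, with constants that do not depend on the
  number of points, and passes to the limit by normal families; its necessity is a Baire category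
  argument followed by division by Blaschke factors.

  From (i) to (ii): the boundary map makes \<open>\<Psi>\<close> a homeomorphism of the disc. If \<open>\<Psi>\<close> were not
  uniformly continuous, there would be pairs \<open>z n\<close>, \<open>w n\<close> that are asymptotic although
  their images stay apart. The pairs escape to the circle, so along a sparse subsequence the images form a separated
  sequence with bounded closeness sums, that is, a Carleson sequence; but the pairs themselves are not
  separated. The same argument applies to the inverse
  (\<open>rho_uniformly_continuous_of_reflects_carleson\<close>).
\<close>


section \<open>Closeness, and Moebius invariance\<close>

text \<open>
  With the hyperbolic distance \<open>d\<close> normalised by \<open>\<rho> = tanh (d / 2)\<close>, closeness is
  \<open>1 / cosh (d / 2)\<^sup>2\<close>, so it is comparable to \<open>exp (- d)\<close>: products of closeness along a chain play
  the role of sums of distances.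
\<close>

definition closeness :: "complex \<Rightarrow> complex \<Rightarrow> real" where
  "closeness z w = 1 - (rho z w)\<^sup>2"

abbreviation mobius :: "complex \<Rightarrow> complex \<Rightarrow> complex" where
  "mobius \<equiv> Moebius_function 0"

lemma rho_nonneg: "0 \<le> rho z w"
  by (simp add: rho_def)

lemma rho_self [simp]: "rho z z = 0"
  by (simp add: rho_def)

lemma rho_eq_cmod_mobius: "rho z w = cmod (mobius w z)"
  by (subst rho_commute) (simp add: rho_def Moebius_function_simple norm_divide norm_minus_commute)

lemma closeness_commute: "closeness z w = closeness w z"
  by (simp add: closeness_def rho_commute)

lemma closeness_self [simp]: "closeness z z = 1"
  by (simp add: closeness_def)

lemma closeness_le_1: "closeness z w \<le> 1"
  by (simp add: closeness_def)

lemma closeness_pos: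
  assumes "cmod z < 1" "cmod w < 1"
  shows "0 < closeness z w"
  using rho_lt_1[OF assms] rho_nonneg[of z w] by (simp add: closeness_def abs_square_less_1)

lemma closeness_nonneg:
  assumes "cmod z < 1" "cmod w < 1"
  shows "0 \<le> closeness z w"
  using closeness_pos[OF assms] by simp

lemma closeness_0: "closeness z 0 = 1 - (cmod z)\<^sup>2" "closeness 0 z = 1 - (cmod z)\<^sup>2"
  by (simp_all add: closeness_def rho_def)

lemma one_minus_cmod_square_pos: "cmod z < 1 \<Longrightarrow> 0 < 1 - (cmod z)\<^sup>2"
  by (simp add: abs_square_less_1)

lemma closeness_formula:
  assumes "cmod z < 1" "cmod w < 1"
  shows "closeness z w = (1 - (cmod z)\<^sup>2) * (1 - (cmod w)\<^sup>2) / (cmod (1 - cnj z * w))\<^sup>2"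
proof -
  have "cmod (1 - cnj z * w) \<noteq> 0"
    using one_minus_cnj_mult_nonzero[OF assms] by (simp only: norm_eq_zero not_False_eq_True)
  then show ?thesis
    using cmod_diff_square[of z w]
    unfolding closeness_def rho_def norm_divide power_divide by (simp add: field_simps)
qed

lemma rho_square: "(rho z w)\<^sup>2 = 1 - closeness z w"
  by (simp add: closeness_def)

lemma cmod_mobius_lt_1: "cmod a < 1 \<Longrightarrow> cmod z < 1 \<Longrightarrow> cmod (mobius a z) < 1"
  by (rule Moebius_function_norm_lt_1)

lemma mobius_inverse:
  assumes "cmod a < 1" "cmod z < 1"
  shows "mobius (- a) (mobius a z) = z" "mobius a (mobius (- a) z) = z"
  using assms by (auto intro!: Moebius_function_compose)

lemma rho_mobius:
  assumes a: "cmod a < 1" and z: "cmod z < 1" and w: "cmod w < 1"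
  shows "rho (mobius a z) (mobius a w) = rho z w"
proof -
  define p where "p = 1 - cnj a * z"
  define q where "q = 1 - cnj a * w"
  define k where "k = 1 - cnj a * a"
  have nz0: "p \<noteq> 0" "q \<noteq> 0" "k \<noteq> 0"
    unfolding p_def q_def k_def using one_minus_cnj_mult_nonzero a z w by blast+
  then have nz: "p \<noteq> 0" "q \<noteq> 0" "k \<noteq> 0" "cnj p \<noteq> 0"
    by (simp_all only: complex_cnj_zero_iff not_False_eq_True)
  have cp: "cnj p = 1 - a * cnj z" by (simp add: p_def)
  have "(z - a) * q - (w - a) * p = k * (z - w)"
    by (simp add: p_def q_def k_def algebra_simps)
  then have num: "mobius a z - mobius a w = k * (z - w) / (p * q)"
    using diff_frac_eq[OF nz(1,2), of "z - a" "w - a"]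
    by (simp only: Moebius_function_simple p_def q_def)
  have "cnj p * q - (cnj z - cnj a) * (w - a) = k * (1 - cnj z * w)"
    by (simp add: cp q_def k_def algebra_simps)
  moreover have "1 - cnj (mobius a z) * mobius a w = (cnj p * q - (cnj z - cnj a) * (w - a)) / (cnj p * q)"
  proof -
    have "cnj (mobius a z) = (cnj z - cnj a) / cnj p" "mobius a w = (w - a) / q"
      by (simp_all add: Moebius_function_simple p_def q_def)
    then have "cnj (mobius a z) * mobius a w = (cnj z - cnj a) * (w - a) / (cnj p * q)"
      by (simp only: times_divide_times_eq)
    then show ?thesis using nz by (simp add: diff_divide_distrib[of "cnj p * q"])
  qed
  ultimately have den: "1 - cnj (mobius a z) * mobius a w = k * (1 - cnj z * w) / (cnj p * q)"
    by (simp only:)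
  have "(k * m / (p * q)) / (k * r / (p * q)) = m / r" if "k \<noteq> 0" "p \<noteq> 0" "q \<noteq> 0"
    for k m p q r :: real
    using that by simp
  from this[of "cmod k" "cmod p" "cmod q"] show ?thesis
    unfolding rho_def num den norm_divide norm_mult complex_mod_cnj using nz by (simp only: norm_eq_zero not_False_eq_True)
qed

lemma closeness_mobius:
  assumes "cmod a < 1" "cmod z < 1" "cmod w < 1"
  shows "closeness (mobius a z) (mobius a w) = closeness z w"
  using rho_mobius[OF assms] by (simp add: closeness_def)

lemma cmod_one_minus_cnj_mult_le_2:
  assumes "cmod z < 1" "cmod w < 1"
  shows "cmod (1 - cnj z * w) \<le> 2"
proof -
  have "cmod (cnj z * w) < 1"
    using norm_mult_less[of "cnj z" 1 w 1] assms by simp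
  then show ?thesis using norm_triangle_ineq4[of 1 "cnj z * w"] by simp
qed

text \<open>
  The multiplicative triangle inequality. By invariance the middle point may be moved to the
  origin, and there it only says that \<open>1 - cnj x * z\<close> has modulus at most 2.
\<close>

lemma closeness_triangle:
  assumes x: "cmod x < 1" and y: "cmod y < 1" and z: "cmod z < 1"
  shows "closeness x y * closeness y z / 4 \<le> closeness x z"
proof -
  define u where "u = mobius y x"
  define v where "v = mobius y z"
  have u: "cmod u < 1" and v: "cmod v < 1"
    using cmod_mobius_lt_1 assms by (auto simp: u_def v_def)
  have nz: "cmod (1 - cnj u * v) > 0"
    using one_minus_cnj_mult_nonzero[OF u v] by simp
  have "closeness x y = 1 - (cmod u)\<^sup>2" "closeness y z = 1 - (cmod v)\<^sup>2"
    using rho_eq_cmod_mobius[of x y] rho_eq_cmod_mobius[of z y]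
    by (simp_all add: closeness_def u_def v_def rho_commute[of y z])
  moreover have "closeness x z = closeness u v"
    using closeness_mobius assms by (simp add: u_def v_def)
  moreover have "(cmod (1 - cnj u * v))\<^sup>2 \<le> 2\<^sup>2"
    using cmod_one_minus_cnj_mult_le_2[OF u v] by (intro power_mono) auto
  moreover have "0 \<le> (1 - (cmod u)\<^sup>2) * (1 - (cmod v)\<^sup>2)"
    using one_minus_cmod_square_pos[OF u] one_minus_cmod_square_pos[OF v] by simp
  ultimately show ?thesis
    using nz divide_left_mono[of "(cmod (1 - cnj u * v))\<^sup>2" 4 "(1 - (cmod u)\<^sup>2) * (1 - (cmod v)\<^sup>2)"]
    by (simp add: closeness_formula[OF u v])
qed

lemma closeness_ge_imp_rho_le:
  assumes "\<eta> \<le> closeness z w" "\<eta> > 0"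
  shows "rho z w \<le> sqrt (1 - \<eta>)"
  using assms rho_nonneg[of z w] by (intro real_le_rsqrt) (simp add: closeness_def)

lemma cmod_diff_le_rho:
  assumes "cmod z < 1" "cmod w < 1"
  shows "cmod (z - w) = rho z w * cmod (1 - cnj z * w)"
  using one_minus_cnj_mult_nonzero[OF assms] by (simp add: rho_def norm_divide)


section \<open>Blaschke division and compactness\<close>

text \<open>
  After a Moebius change of variable the zero sits at the origin, and this is the Schwarz lemma.
\<close>

lemma divide_by_blaschke_factor:
  assumes holf: "f holomorphic_on unit_disc" and bd: "\<And>z. cmod z < 1 \<Longrightarrow> cmod (f z) \<le> M"
    and s: "cmod s < 1" and fs: "f s = 0"
  obtains g where "g holomorphic_on unit_disc" "\<And>z. cmod z < 1 \<Longrightarrow> cmod (g z) \<le> M"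
    "\<And>z. cmod z < 1 \<Longrightarrow> f z = mobius s z * g z"
proof -
  define F where "F = f \<circ> mobius (- s)"
  have s': "cmod (- s) < 1" using s by simp
  have img: "mobius a ` unit_disc \<subseteq> unit_disc" if "cmod a < 1" for a
    using cmod_mobius_lt_1[OF that] by auto
  have holF: "F holomorphic_on ball 0 1"
    unfolding F_def
    by (rule holomorphic_on_compose_gen[OF Moebius_function_holomorphic[OF s'] holf img[OF s']])
  have F0: "F 0 = 0"
    by (simp add: F_def Moebius_function_of_zero fs)
  have bdF: "cmod (F z) \<le> M" if "cmod z < 1" for z
    using bd[OF cmod_mobius_lt_1[OF s' that]] by (simp add: F_def)
  obtain h where h: "h holomorphic_on ball 0 1" "\<And>z. norm z < 1 \<Longrightarrow> F z = z * h z" "deriv F 0 = h 0"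
    using Schwarz3[OF holF F0] by blast
  have bdh: "cmod (h z) \<le> M" if z: "cmod z < 1" for z
  proof (rule dense_ge)
    fix M' assume M': "M < M'"
    have "0 \<le> M" using bdF[of 0] F0 by simp
    then have M'0: "M' > 0" using M' by simp
    have hol: "(\<lambda>z. F z / of_real M') holomorphic_on ball 0 1"
      using M'0 by (intro holomorphic_intros holF) auto
    have lt: "cmod (F z / of_real M') < 1" if "cmod z < 1" for z
      using bdF[OF that] M' M'0 by (simp add: norm_divide)
    have d: "deriv (\<lambda>z. F z / of_real M') 0 = deriv F 0 / of_real M'"
      using holomorphic_on_imp_differentiable_at[OF holF] by (intro deriv_cdivide_right) auto
    show "cmod (h z) \<le> M'"
    proof (cases "z = 0")
      case True
      have "cmod (deriv (\<lambda>z. F z / of_real M') 0) \<le> 1"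
        by (rule Schwarz_Lemma(2)[OF hol _ lt z]) (simp_all add: F0)
      then show ?thesis using M'0 True h(3) d by (simp add: norm_divide)
    next
      case False
      have "cmod (F z / of_real M') \<le> cmod z"
        by (rule Schwarz_Lemma(1)[OF hol _ lt z]) (simp_all add: F0)
      then show ?thesis using M'0 False h(2)[OF z] by (simp add: norm_divide norm_mult field_simps)
    qed
  qed
  show thesis
  proof
    show "(h \<circ> mobius s) holomorphic_on unit_disc"
      by (rule holomorphic_on_compose_gen[OF Moebius_function_holomorphic[OF s] h(1) img[OF s]])
    show "cmod ((h \<circ> mobius s) z) \<le> M" if "cmod z < 1" for z
      using bdh[OF cmod_mobius_lt_1[OF s that]] by simp
    show "f z = mobius s z * (h \<circ> mobius s) z" if "cmod z < 1" for z
      using h(2)[OF cmod_mobius_lt_1[OF s that]] mobius_inverse(1)[OF s that] by (simp add: F_def)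
  qed
qed

text \<open>
  Dividing out the zeros one at a time costs nothing in the sup norm, so what remains of
  \<open>f\<close> is the product of its Blaschke factors times a function still bounded by \<open>M\<close>.
\<close>

lemma cmod_le_prod_rho_of_zeros:
  assumes "finite S" "S \<subseteq> unit_disc" "f holomorphic_on unit_disc"
    "\<And>z. cmod z < 1 \<Longrightarrow> cmod (f z) \<le> M" "\<And>s. s \<in> S \<Longrightarrow> f s = 0" "cmod z < 1"
  shows "cmod (f z) \<le> M * (\<Prod>s\<in>S. rho z s)"
  using assms
proof (induction S arbitrary: f rule: finite_induct)
  case empty
  then show ?case by simp
next
  case (insert s S)
  have s: "cmod s < 1" using insert.prems by simp
  obtain g where g: "g holomorphic_on unit_disc" "\<And>z. cmod z < 1 \<Longrightarrow> cmod (g z) \<le> M"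
    "\<And>z. cmod z < 1 \<Longrightarrow> f z = mobius s z * g z"
    using divide_by_blaschke_factor[of f M s] insert.prems s by auto
  have "g t = 0" if "t \<in> S" for t
  proof -
    have t: "cmod t < 1" "t \<noteq> s" "f t = 0" using that insert by auto
    have "mobius s t \<noteq> 0"
      using t s one_minus_cnj_mult_nonzero[of s t] by (simp add: Moebius_function_simple)
    then show ?thesis using g(3)[OF t(1)] t(3) by simp
  qed
  then have "cmod (g z) \<le> M * (\<Prod>s\<in>S. rho z s)"
    using insert.IH[OF _ g(1,2)] insert.prems by auto
  then have "rho z s * cmod (g z) \<le> rho z s * (M * (\<Prod>s\<in>S. rho z s))"
    by (rule mult_left_mono[OF _ rho_nonneg])
  then show ?case
    using g(3)[of z] insert.prems insert.hyps by (simp add: norm_mult rho_eq_cmod_mobius ac_simps)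
qed

definition interpolates :: "real \<Rightarrow> nat set \<Rightarrow> (nat \<Rightarrow> complex) \<Rightarrow> (nat \<Rightarrow> complex) \<Rightarrow> bool" where
  "interpolates M I \<Lambda> a \<longleftrightarrow>
     (\<exists>f. f holomorphic_on unit_disc \<and> (\<forall>z. cmod z < 1 \<longrightarrow> cmod (f z) \<le> M) \<and> (\<forall>j\<in>I. f (\<Lambda> j) = a j))"

lemma interpolates_mono:
  assumes "interpolates M I \<Lambda> a" "M \<le> M'"
  shows "interpolates M' I \<Lambda> a"
  using assms unfolding interpolates_def by (meson order_trans)

lemma interpolates_diff:
  assumes "interpolates M I \<Lambda> a" "interpolates M' I \<Lambda> b"
  shows "interpolates (M + M') I \<Lambda> (\<lambda>j. a j - b j)"
proof -
  obtain f g where f: "f holomorphic_on unit_disc" "\<And>z. cmod z < 1 \<Longrightarrow> cmod (f z) \<le> M" "\<And>j. j \<in> I \<Longrightarrow> f (\<Lambda> j) = a j"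
    and g: "g holomorphic_on unit_disc" "\<And>z. cmod z < 1 \<Longrightarrow> cmod (g z) \<le> M'" "\<And>j. j \<in> I \<Longrightarrow> g (\<Lambda> j) = b j"
    using assms unfolding interpolates_def by blast
  have "cmod (f z - g z) \<le> M + M'" if "cmod z < 1" for z
    using norm_triangle_ineq4[of "f z" "g z"] f(2)[OF that] g(2)[OF that] by linarith
  moreover have "(\<lambda>z. f z - g z) holomorphic_on unit_disc"
    by (intro holomorphic_intros f g)
  ultimately show ?thesis
    unfolding interpolates_def using f(3) g(3) by (intro exI[of _ "\<lambda>z. f z - g z"]) auto
qed

lemma carleson_sequence_iff_interpolates:
  "carleson_sequence I \<Lambda> \<longleftrightarrow>
     \<Lambda> \<in> I \<rightarrow> unit_disc \<and> (\<forall>a. bounded (a ` I) \<longrightarrow> (\<exists>M. interpolates M I \<Lambda> a))"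
proof -
  have H: "f \<in> H_infinity \<longleftrightarrow> f holomorphic_on unit_disc \<and> (\<exists>M. \<forall>z. cmod z < 1 \<longrightarrow> cmod (f z) \<le> M)" for f
    unfolding H_infinity_def bounded_iff by (simp, simp add: Ball_def)
  have "(\<exists>f\<in>H_infinity. \<forall>j\<in>I. f (\<Lambda> j) = a j) \<longleftrightarrow> (\<exists>M. interpolates M I \<Lambda> a)" for a
    unfolding interpolates_def Bex_def H by auto
  then show ?thesis unfolding carleson_sequence_def by simp
qed

text \<open>
  Montel's theorem: bounded solutions of the finite pieces have a subsequence converging to a solution.
\<close>

lemma interpolates_limit:
  assumes \<Lambda>: "\<Lambda> \<in> I \<rightarrow> unit_disc" and fin: "\<And>n. interpolates M (I \<inter> {..<n}) \<Lambda> a"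
  shows "interpolates M I \<Lambda> a"
proof -
  have "\<forall>n. \<exists>f. f holomorphic_on unit_disc \<and> (\<forall>z. cmod z < 1 \<longrightarrow> cmod (f z) \<le> M) \<and>
      (\<forall>j\<in>I \<inter> {..<n}. f (\<Lambda> j) = a j)"
    using fin unfolding interpolates_def by blast
  then obtain f where "\<And>n. f n holomorphic_on unit_disc \<and> (\<forall>z. cmod z < 1 \<longrightarrow> cmod (f n z) \<le> M) \<and>
      (\<forall>j\<in>I \<inter> {..<n}. f n (\<Lambda> j) = a j)"
    by metis
  then have f: "\<And>n. f n holomorphic_on unit_disc" "\<And>n z. cmod z < 1 \<Longrightarrow> cmod (f n z) \<le> M"
    "\<And>n j. j \<in> I \<Longrightarrow> j < n \<Longrightarrow> f n (\<Lambda> j) = a j"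
    by blast+
  define \<H> where "\<H> = {h. h holomorphic_on unit_disc \<and> (\<forall>z. cmod z < 1 \<longrightarrow> cmod (h z) \<le> M)}"
  obtain g r where g: "g holomorphic_on unit_disc" and r: "strict_mono (r :: nat \<Rightarrow> nat)"
    and lim: "\<And>x. x \<in> unit_disc \<Longrightarrow> (\<lambda>n. f (r n) x) \<longlonglongrightarrow> g x"
  proof (rule Montel[of unit_disc \<H> f])
    show "\<exists>B. \<forall>h\<in>\<H>. \<forall>z\<in>K. cmod (h z) \<le> B" if "K \<subseteq> unit_disc" for K
      using that by (intro exI[of _ M]) (auto simp: \<H>_def subset_iff)
    show "range f \<subseteq> \<H>" using f(1,2) by (auto simp: \<H>_def)
  qed (auto simp: \<H>_def)
  have "cmod (g z) \<le> M" if "cmod z < 1" for z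
  proof (rule LIMSEQ_le_const2[OF tendsto_norm[OF lim]])
    show "z \<in> unit_disc" using that by simp
    show "\<exists>N. \<forall>n\<ge>N. cmod (f (r n) z) \<le> M" using f(2)[OF that] by blast
  qed
  moreover have "g (\<Lambda> j) = a j" if j: "j \<in> I" for j
  proof (rule LIMSEQ_unique[OF lim])
    show "\<Lambda> j \<in> unit_disc" using \<Lambda> j by blast
    have "f (r n) (\<Lambda> j) = a j" if "n \<ge> Suc j" for n
    proof -
      have "n \<le> r n" using r by (rule strict_mono_imp_increasing)
      then show ?thesis using f(3)[OF j] that by simp
    qed
    then have "eventually (\<lambda>n. f (r n) (\<Lambda> j) = a j) sequentially"
      by (rule eventually_sequentiallyI)
    then show "(\<lambda>n. f (r n) (\<Lambda> j)) \<longlonglongrightarrow> a j" by (rule tendsto_eventually)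
  qed
  ultimately show ?thesis unfolding interpolates_def using g by blast
qed

section \<open>Carleson sequences are separated and have bounded closeness sums\<close>

text \<open>
  The uniform boundedness step, in the form of a Baire category argument on the
  space of zero-one data, that is, of subsets \<open>A\<close> of the index set. By compactness, failure with bound
  \<open>M\<close> is already visible on a finite initial part of the data. If no initial part forced a bound,
  one could fix longer and longer initial parts, each excluding a larger bound, and the
  limiting data would admit no bound at all.
\<close>

lemma carleson_sequence_bound_on_cylinder:
  assumes carl: "carleson_sequence I \<Lambda>"
  shows "\<exists>M N A. \<forall>A'. A' \<inter> {..<N} = A \<inter> {..<N} \<longrightarrow> interpolates M I \<Lambda> (\<lambda>j. of_bool (j \<in> A'))"
proof (rule ccontr)
  assume neg: "\<not> ?thesis"
  have \<Lambda>: "\<Lambda> \<in> I \<rightarrow> unit_disc"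
    using carl by (simp add: carleson_sequence_def)
  have ex: "\<exists>M. interpolates M I \<Lambda> a" if "bounded (a ` I)" for a
    using carl that by (simp add: carleson_sequence_iff_interpolates)
  define good where "good M A \<longleftrightarrow> interpolates M I \<Lambda> (\<lambda>j. of_bool (j \<in> A))" for M A
  define agree where "agree N A' A \<longleftrightarrow> A' \<inter> {..<N} = A \<inter> {..<N}" for N :: nat and A' A
  have fails: "\<exists>A'. agree N A' A \<and> \<not> good M A'" for M N A
    using neg unfolding good_def[symmetric] agree_def[symmetric] by blast
  have extend: "\<exists>A' N'. N \<le> N' \<and> agree N A' A \<and> (\<forall>A''. agree N' A'' A' \<longrightarrow> \<not> good M A'')" for M N A
  proof -
    obtain A' where A': "agree N A' A" "\<not> good M A'"
      using fails by blast
    have "\<exists>N'\<ge>N. \<forall>A''. agree N' A'' A' \<longrightarrow> \<not> good M A''"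
    proof (rule ccontr)
      assume *: "\<not> ?thesis"
      have "good M A'"
        unfolding good_def
      proof (rule interpolates_limit[OF \<Lambda>])
        fix n
        have "N \<le> max n N" by simp
        then obtain A'' where A'': "agree (max n N) A'' A'" "good M A''"
          using * by blast
        have eq: "j \<in> A'' \<longleftrightarrow> j \<in> A'" if "j < n" for j
        proof -
          have "j \<in> {..<max n N}" using that by simp
          then show ?thesis using A''(1) unfolding agree_def by blast
        qed
        obtain f where "f holomorphic_on unit_disc" "\<forall>z. cmod z < 1 \<longrightarrow> cmod (f z) \<le> M"
          "\<forall>j\<in>I. f (\<Lambda> j) = of_bool (j \<in> A'')"
          using A''(2) unfolding good_def interpolates_def by blast
        then show "interpolates M (I \<inter> {..<n}) \<Lambda> (\<lambda>j. of_bool (j \<in> A'))"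
          unfolding interpolates_def using eq by (intro exI[of _ f]) simp
      qed
      with A'(2) show False ..
    qed
    with A'(1) show ?thesis by blast
  qed
  define P where "P = (\<lambda>i x y. snd x \<le> snd y \<and> agree (snd x) (fst y) (fst x) \<and>
      (\<forall>A''. agree (snd y) A'' (fst y) \<longrightarrow> \<not> good (real i) A''))"
  have "\<exists>s :: nat \<Rightarrow> nat set \<times> nat. \<forall>i. True \<and> P i (s i) (s (Suc i))"
  proof (rule dependent_nat_choice)
    fix x :: "nat set \<times> nat" and i
    obtain A' N' where "snd x \<le> N' \<and> agree (snd x) A' (fst x) \<and>
      (\<forall>A''. agree N' A'' A' \<longrightarrow> \<not> good (real i) A'')"
      using extend by blast
    then have "P i x (A', N')" by (simp add: P_def)
    then show "\<exists>y. True \<and> P i x y" by blast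
  qed simp
  then obtain s where P: "\<And>i. P i (s i) (s (Suc i))" by blast
  have s: "snd (s i) \<le> snd (s (Suc i)) \<and> agree (snd (s i)) (fst (s (Suc i))) (fst (s i)) \<and>
      (\<forall>A''. agree (snd (s (Suc i))) A'' (fst (s (Suc i))) \<longrightarrow> \<not> good (real i) A'')" for i
    using P[of i] unfolding P_def .
  have mono: "snd (s i) \<le> snd (s m) \<and> fst (s m) \<inter> {..<snd (s i)} = fst (s i) \<inter> {..<snd (s i)}"
    if "i \<le> m" for i m
    using that
  proof (induction m rule: dec_induct)
    case base
    show ?case by simp
  next
    case (step m)
    have le: "snd (s m) \<le> snd (s (Suc m))" and "agree (snd (s m)) (fst (s (Suc m))) (fst (s m))"
      using s[THEN conjunct1] s[THEN conjunct2, THEN conjunct1] by this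
    then have eq: "fst (s (Suc m)) \<inter> {..<snd (s m)} = fst (s m) \<inter> {..<snd (s m)}"
      by (simp only: agree_def)
    have "fst (s (Suc m)) \<inter> {..<snd (s i)} = fst (s m) \<inter> {..<snd (s i)}"
    proof -
      have "{..<snd (s i)} = {..<snd (s m)} \<inter> {..<snd (s i)}" using step.IH[THEN conjunct1] by auto
      then show ?thesis using eq by (metis Int_assoc)
    qed
    then show ?case using step.IH le by (metis order_trans)
  qed
  define A where "A = (\<Union>i. fst (s i) \<inter> {..<snd (s i)})"
  have A_agree: "A \<inter> {..<snd (s i)} = fst (s i) \<inter> {..<snd (s i)}" for i
  proof (intro equalityI subsetI)
    fix x assume "x \<in> A \<inter> {..<snd (s i)}"
    then obtain m where m: "x \<in> fst (s m) \<inter> {..<snd (s m)}" and x: "x < snd (s i)"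
      unfolding A_def by auto
    show "x \<in> fst (s i) \<inter> {..<snd (s i)}"
    proof (cases "i \<le> m")
      case True
      have "x \<in> fst (s m) \<inter> {..<snd (s i)}" using m x by simp
      then show ?thesis by (simp only: mono[OF True])
    next
      case False
      then have "m \<le> i" by simp
      have "x \<in> fst (s i) \<inter> {..<snd (s m)}" using m by (simp only: mono[OF \<open>m \<le> i\<close>])
      then show ?thesis using x by simp
    qed
  qed (auto simp: A_def)
  have bad: "\<not> good (real i) A" for i
  proof -
    have "agree (snd (s (Suc i))) A (fst (s (Suc i)))" using A_agree by (simp only: agree_def)
    then show ?thesis by (rule s[THEN conjunct2, THEN conjunct2, rule_format])
  qed
  have "finite ((\<lambda>j. of_bool (j \<in> A) :: complex) ` I)"
    by (rule finite_subset[of _ "{0, 1}"]) auto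
  then obtain M where "good M A"
    using ex[OF finite_imp_bounded] unfolding good_def by blast
  then have "good (real (nat \<lceil>M\<rceil>)) A"
    unfolding good_def by (rule interpolates_mono) linarith
  with bad show False by blast
qed

text \<open>
  Far out, \<open>of_bool (j = k)\<close> is the difference of two data sets in the same cylinder, with and without
  \<open>k\<close>; only finitely many indices remain, and each has a bound of its own.
\<close>

lemma carleson_sequence_uniform_bound:
  assumes carl: "carleson_sequence I \<Lambda>"
  obtains M where "\<And>k. k \<in> I \<Longrightarrow> interpolates M I \<Lambda> (\<lambda>j. of_bool (j = k))"
proof -
  obtain M N A where M: "\<And>A'. A' \<inter> {..<N} = A \<inter> {..<N} \<Longrightarrow> interpolates M I \<Lambda> (\<lambda>j. of_bool (j \<in> A'))"
    using carleson_sequence_bound_on_cylinder[OF carl] by blast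
  have "\<exists>M. interpolates M I \<Lambda> (\<lambda>j. of_bool (j = k))" for k
  proof -
    have "finite ((\<lambda>j. of_bool (j = k) :: complex) ` I)"
      by (rule finite_subset[of _ "{0, 1}"]) auto
    then show ?thesis
      by (rule carl[unfolded carleson_sequence_iff_interpolates, THEN conjunct2, rule_format,
            OF finite_imp_bounded])
  qed
  then obtain m where m: "\<And>k. interpolates (m k) I \<Lambda> (\<lambda>j. of_bool (j = k))"
    by metis
  define M' where "M' = \<bar>M + M\<bar> + (\<Sum>k<N. \<bar>m k\<bar>)"
  have "interpolates M' I \<Lambda> (\<lambda>j. of_bool (j = k))" for k
  proof (cases "k < N")
    case True
    then have "\<bar>m k\<bar> \<le> (\<Sum>k<N. \<bar>m k\<bar>)"
      by (intro member_le_sum) auto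
    then show ?thesis unfolding M'_def by (intro interpolates_mono[OF m[of k]]) linarith
  next
    case False
    have "interpolates (M + M) I \<Lambda> (\<lambda>j. of_bool (j \<in> insert k A) - of_bool (j \<in> A - {k}))"
      using False by (intro interpolates_diff M) auto
    moreover have "(\<lambda>j. of_bool (j \<in> insert k A) - of_bool (j \<in> A - {k}) :: complex) = (\<lambda>j. of_bool (j = k))"
      by auto
    moreover have "M + M \<le> M'"
    proof -
      have "0 \<le> (\<Sum>k<N. \<bar>m k\<bar>)" by (simp add: sum_nonneg)
      then show ?thesis unfolding M'_def by linarith
    qed
    ultimately show ?thesis using interpolates_mono by metis
  qed
  then show thesis using that by blast
qed

text \<open>
  The geometric side of Carleson's theorem. The second condition is the Carleson measure condition for the sum of
  the point masses \<open>1 - (cmod (\<Lambda> j))\<^sup>2\<close> at \<open>\<Lambda> j\<close>, tested on reproducing kernels at the points of the sequence.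
  Quantifying over finite subsets avoids any convention about infinite sums.
\<close>

definition dispersed :: "nat set \<Rightarrow> (nat \<Rightarrow> complex) \<Rightarrow> bool" where
  "dispersed I \<Lambda> \<longleftrightarrow> \<Lambda> \<in> I \<rightarrow> unit_disc \<and>
     (\<exists>\<epsilon>>0. \<forall>j\<in>I. \<forall>k\<in>I. j \<noteq> k \<longrightarrow> \<epsilon> \<le> rho (\<Lambda> j) (\<Lambda> k)) \<and>
     (\<exists>C. \<forall>k\<in>I. \<forall>J\<subseteq>I. finite J \<longrightarrow> (\<Sum>j\<in>J. closeness (\<Lambda> j) (\<Lambda> k)) \<le> C)"

text \<open>
  A function with value 1 at one point and 0 at the others, bounded by \<open>M\<close>, shows that the Blaschke product over
  the others is at least \<open>1 / M\<close>. Its square is a product of factors \<open>1 - closeness\<close>, so taking logarithms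
  bounds the closeness sums; a single factor gives separation.
\<close>

lemma carleson_sequence_imp_dispersed:
  assumes carl: "carleson_sequence I \<Lambda>"
  shows "dispersed I \<Lambda>"
proof -
  have \<Lambda>: "\<And>j. j \<in> I \<Longrightarrow> cmod (\<Lambda> j) < 1"
    using carl unfolding carleson_sequence_def by auto
  obtain M0 where M0: "\<And>k. k \<in> I \<Longrightarrow> interpolates M0 I \<Lambda> (\<lambda>j. of_bool (j = k))"
    using carleson_sequence_uniform_bound[OF carl] by blast
  define M where "M = max M0 1"
  have M: "interpolates M I \<Lambda> (\<lambda>j. of_bool (j = k))" if "k \<in> I" for k
    using interpolates_mono[OF M0[OF that]] by (simp add: M_def)
  have M1: "1 \<le> M" by (simp add: M_def)
  have inj: "inj_on \<Lambda> I"
  proof (rule inj_onI)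
    fix j k assume "j \<in> I" "k \<in> I" "\<Lambda> j = \<Lambda> k"
    then show "j = k" using M[of k] unfolding interpolates_def by (metis of_bool_eq_iff)
  qed
  have prod: "1 \<le> M * (\<Prod>j\<in>J. rho (\<Lambda> k) (\<Lambda> j))"
    if k: "k \<in> I" and J: "J \<subseteq> I - {k}" "finite J" for k J
  proof -
    obtain f where f: "f holomorphic_on unit_disc" "\<And>z. cmod z < 1 \<Longrightarrow> cmod (f z) \<le> M"
      "\<And>j. j \<in> I \<Longrightarrow> f (\<Lambda> j) = of_bool (j = k)"
      using M[OF k] unfolding interpolates_def by auto
    have "cmod (f (\<Lambda> k)) \<le> M * (\<Prod>s\<in>\<Lambda> ` J. rho (\<Lambda> k) s)"
      using J k \<Lambda> f by (intro cmod_le_prod_rho_of_zeros) (auto simp: subset_iff)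
    moreover have "(\<Prod>s\<in>\<Lambda> ` J. rho (\<Lambda> k) s) = (\<Prod>j\<in>J. rho (\<Lambda> k) (\<Lambda> j))"
      using J inj by (subst prod.reindex) (auto intro: inj_on_subset)
    ultimately show ?thesis using f(3)[OF k] by simp
  qed
  have sep: "1 / M \<le> rho (\<Lambda> j) (\<Lambda> k)" if "j \<in> I" "k \<in> I" "j \<noteq> k" for j k
    using prod[of j "{k}"] that M1 by (simp add: field_simps)
  have sum: "(\<Sum>j\<in>J. closeness (\<Lambda> j) (\<Lambda> k)) \<le> 1 + 2 * ln M"
    if k: "k \<in> I" and J: "J \<subseteq> I" "finite J" for k J
  proof -
    let ?J = "J - {k}"
    have "1 \<le> (M * (\<Prod>j\<in>?J. rho (\<Lambda> k) (\<Lambda> j)))\<^sup>2"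
      using prod[OF k, of ?J] J by (intro one_le_power) auto
    also have "\<dots> = M\<^sup>2 * (\<Prod>j\<in>?J. 1 - closeness (\<Lambda> j) (\<Lambda> k))"
      by (simp add: power_mult_distrib prod_power_distrib rho_square closeness_commute)
    also have "\<dots> \<le> M\<^sup>2 * (\<Prod>j\<in>?J. exp (- closeness (\<Lambda> j) (\<Lambda> k)))"
      using closeness_le_1 exp_ge_add_one_self[of "- closeness (\<Lambda> j) (\<Lambda> k)" for j]
      by (intro mult_left_mono prod_mono) auto
    also have "\<dots> = M\<^sup>2 * exp (- (\<Sum>j\<in>?J. closeness (\<Lambda> j) (\<Lambda> k)))"
      using J by (simp add: exp_sum sum_negf[symmetric])
    finally have "exp (\<Sum>j\<in>?J. closeness (\<Lambda> j) (\<Lambda> k)) \<le> M\<^sup>2"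
      by (simp add: exp_minus field_simps)
    then have "(\<Sum>j\<in>?J. closeness (\<Lambda> j) (\<Lambda> k)) \<le> ln (M\<^sup>2)"
      using M1 by (subst ln_ge_iff) auto
    then have "(\<Sum>j\<in>?J. closeness (\<Lambda> j) (\<Lambda> k)) \<le> 2 * ln M"
      using M1 by (simp add: ln_realpow)
    moreover have "(\<Sum>j\<in>J. closeness (\<Lambda> j) (\<Lambda> k)) \<le> 1 + (\<Sum>j\<in>?J. closeness (\<Lambda> j) (\<Lambda> k))"
      using J by (cases "k \<in> J") (auto simp: sum.remove)
    ultimately show ?thesis by linarith
  qed
  show ?thesis
    unfolding dispersed_def
  proof (intro conjI)
    show "\<Lambda> \<in> I \<rightarrow> unit_disc" using \<Lambda> by auto
    have "1 / M > 0" using M1 by simp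
    then show "\<exists>\<epsilon>>0. \<forall>j\<in>I. \<forall>k\<in>I. j \<noteq> k \<longrightarrow> \<epsilon> \<le> rho (\<Lambda> j) (\<Lambda> k)" using sep by blast
    show "\<exists>C. \<forall>k\<in>I. \<forall>J\<subseteq>I. finite J \<longrightarrow> (\<Sum>j\<in>J. closeness (\<Lambda> j) (\<Lambda> k)) \<le> C" using sum by blast
  qed
qed


section \<open>Dispersed sequences are Carleson sequences\<close>

text \<open>
  A discrete form of \<open>\<integral> exp (- t) dt \<le> 1\<close>: the weights \<open>b j\<close> are laid out along a half line in
  order of decreasing \<open>\<kappa>\<close>, and the exponent at \<open>j\<close> is the total weight up to and including \<open>j\<close>. Ties in
  \<open>\<kappa>\<close> only enlarge the exponents. This is what makes the bound on Jones's functions independent of the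
  number of points.
\<close>

lemma sum_exp_neg_tail_le:
  fixes b \<kappa> :: "'a \<Rightarrow> real"
  assumes "finite J" "\<And>j. j \<in> J \<Longrightarrow> 0 \<le> b j"
  shows "(\<Sum>j\<in>J. b j * exp (- (\<Sum>k\<in>{k\<in>J. \<kappa> j \<le> \<kappa> k}. b k))) \<le> 1 - exp (- (\<Sum>j\<in>J. b j))"
  using assms
proof (induction J rule: finite_ranking_induct[where f = "\<lambda>j. - \<kappa> j"])
  case empty
  then show ?case by simp
next
  case (insert x S)
  show ?case
  proof (cases "x \<in> S")
    case True
    then show ?thesis using insert by (simp add: insert_absorb)
  next
    case False
    let ?S = "\<Sum>j\<in>S. b j"
    have bx: "0 \<le> b x" using insert.prems by simp
    have "{k \<in> insert x S. \<kappa> x \<le> \<kappa> k} = insert x S"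
      using insert.hyps by auto
    then have "b x * exp (- (\<Sum>k\<in>{k\<in>insert x S. \<kappa> x \<le> \<kappa> k}. b k)) = b x * exp (- b x) * exp (- ?S)"
      using False insert.hyps by (simp add: exp_add[symmetric])
    also have "\<dots> \<le> (1 - exp (- b x)) * exp (- ?S)"
    proof (rule mult_right_mono)
      have "b x \<le> exp (b x) - 1"
        using exp_ge_add_one_self[of "b x"] by linarith
      then have "b x * exp (- b x) \<le> (exp (b x) - 1) * exp (- b x)"
        by (rule mult_right_mono) simp
      also have "\<dots> = 1 - exp (- b x)"
        by (simp add: left_diff_distrib exp_add[symmetric])
      finally show "b x * exp (- b x) \<le> 1 - exp (- b x)" .
    qed simp
    finally have 1: "b x * exp (- (\<Sum>k\<in>{k\<in>insert x S. \<kappa> x \<le> \<kappa> k}. b k)) \<le> exp (- ?S) - exp (- b x - ?S)"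
      by (simp add: left_diff_distrib exp_add[symmetric])
    have "(\<Sum>j\<in>S. b j * exp (- (\<Sum>k\<in>{k\<in>insert x S. \<kappa> j \<le> \<kappa> k}. b k)))
        \<le> (\<Sum>j\<in>S. b j * exp (- (\<Sum>k\<in>{k\<in>S. \<kappa> j \<le> \<kappa> k}. b k)))"
    proof (intro sum_mono mult_left_mono)
      fix j assume j: "j \<in> S"
      have "(\<Sum>k\<in>{k\<in>S. \<kappa> j \<le> \<kappa> k}. b k) \<le> (\<Sum>k\<in>{k\<in>insert x S. \<kappa> j \<le> \<kappa> k}. b k)"
        using insert.hyps insert.prems by (intro sum_mono2) auto
      then show "exp (- (\<Sum>k\<in>{k\<in>insert x S. \<kappa> j \<le> \<kappa> k}. b k)) \<le> exp (- (\<Sum>k\<in>{k\<in>S. \<kappa> j \<le> \<kappa> k}. b k))"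
        by simp
      show "0 \<le> b j" using insert.prems j by simp
    qed
    also have "\<dots> \<le> 1 - exp (- ?S)" using insert by simp
    finally show ?thesis
      using 1 False insert.hyps by (simp add: algebra_simps)
  qed
qed

lemma Re_cayley:
  fixes w :: complex
  shows "Re ((1 + w) / (1 - w)) = (1 - (cmod w)\<^sup>2) / (cmod (1 - w))\<^sup>2"
proof -
  have "Re ((1 + w) * cnj (1 - w)) = 1 - (cmod w)\<^sup>2"
    unfolding cmod_power2 by (simp add: power2_eq_square algebra_simps)
  then show ?thesis
    unfolding complex_div_cnj[of "1 + w" "1 - w"] of_real_power[symmetric] Re_divide_of_real
    by (simp only:)
qed

text \<open>
  P. Jones's construction. The function \<open>F j\<close> is a normalised Blaschke product vanishing at the other points,
  times a peaking factor \<open>P j\<close> whose modulus at \<open>z\<close> is \<open>b j z\<close>, times an exponential that contributes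
  \<open>exp (- \<Sum>k\<in>L j. b k z)\<close> over the points \<open>k\<close> no farther from the circle than \<open>j\<close>. The normalisation of the
  exponential at \<open>\<Lambda> j\<close> costs only a constant, because for these \<open>k\<close> the real part of \<open>T k (\<Lambda> j)\<close> is at
  most twice the closeness of the two points. Then \<open>\<Sum>j. cmod (F j z)\<close> is bounded by \<open>sum_exp_neg_tail_le\<close>.
\<close>

lemma interpolates_finite:
  assumes J: "finite J" and \<Lambda>: "\<And>j. j \<in> J \<Longrightarrow> cmod (\<Lambda> j) < 1"
    and \<epsilon>: "0 < \<epsilon>" and sep: "\<And>j k. j \<in> J \<Longrightarrow> k \<in> J \<Longrightarrow> j \<noteq> k \<Longrightarrow> \<epsilon> \<le> rho (\<Lambda> j) (\<Lambda> k)"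
    and sum: "\<And>k J'. k \<in> J \<Longrightarrow> J' \<subseteq> J \<Longrightarrow> (\<Sum>j\<in>J'. closeness (\<Lambda> j) (\<Lambda> k)) \<le> C"
    and a: "\<And>j. j \<in> J \<Longrightarrow> cmod (a j) \<le> R" "0 \<le> R"
  shows "interpolates (R * (exp (C / \<epsilon>\<^sup>2) * exp (2 * C))) J \<Lambda> a"
proof -
  define B where "B j z = (\<Prod>k\<in>J - {j}. mobius (\<Lambda> k) z)" for j z
  define s where "s j = 1 - (cmod (\<Lambda> j))\<^sup>2" for j
  define b where "b j z = (s j)\<^sup>2 / (cmod (1 - cnj (\<Lambda> j) * z))\<^sup>2" for j z
  define P where "P j z = (of_real (s j) / (1 - cnj (\<Lambda> j) * z))\<^sup>2" for j z
  define T where "T k z = of_real (s k) * ((1 + cnj (\<Lambda> k) * z) / (1 - cnj (\<Lambda> k) * z))" for k z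
  define L where "L j = {k\<in>J. cmod (\<Lambda> j) \<le> cmod (\<Lambda> k)}" for j
  define E where "E j z = (\<Sum>k\<in>L j. T k z)" for j z
  define F where "F j z = B j z / B j (\<Lambda> j) * P j z * exp (E j (\<Lambda> j) - E j z)" for j z
  have nz: "1 - cnj (\<Lambda> j) * z \<noteq> 0" if "j \<in> J" "cmod z < 1" for j z
    using one_minus_cnj_mult_nonzero \<Lambda> that by blast
  have s: "0 < s j" "s j \<le> 1" if "j \<in> J" for j
    using one_minus_cmod_square_pos[OF \<Lambda>[OF that]] by (auto simp: s_def)
  have L: "finite (L j)" "L j \<subseteq> J" for j
    using J by (auto simp: L_def)
  have ReT: "Re (T k z) = s k * ((1 - (cmod (\<Lambda> k))\<^sup>2 * (cmod z)\<^sup>2) / (cmod (1 - cnj (\<Lambda> k) * z))\<^sup>2)"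
    if "k \<in> J" "cmod z < 1" for k z
  proof -
    have "Re (of_real c * w) = c * Re w" for c w by simp
    then show ?thesis
      unfolding T_def by (simp only: Re_cayley norm_mult power_mult_distrib complex_mod_cnj)
  qed
  \<comment> \<open>The weights \<open>b k z\<close> of the summation lemma are a lower bound for the real parts in the exponent.\<close>
  have ReE_lower: "(\<Sum>k\<in>L j. b k z) \<le> Re (E j z)" if z: "cmod z < 1" for j z
    unfolding E_def Re_sum
  proof (rule sum_mono)
    fix k assume "k \<in> L j"
    then have k: "k \<in> J" using L by blast
    have "(cmod (\<Lambda> k))\<^sup>2 * (cmod z)\<^sup>2 \<le> (cmod (\<Lambda> k))\<^sup>2"
      using z by (intro mult_left_le) (auto simp: abs_square_le_1)
    then have "s k * s k \<le> s k * (1 - (cmod (\<Lambda> k))\<^sup>2 * (cmod z)\<^sup>2)"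
      using s[OF k] by (intro mult_left_mono) (auto simp: s_def)
    then show "b k z \<le> Re (T k z)"
      unfolding ReT[OF k z] b_def times_divide_eq_right power2_eq_square[of "s k"]
      by (rule divide_right_mono) simp
  qed
  have ReE_upper: "Re (E j (\<Lambda> j)) \<le> 2 * C" if j: "j \<in> J" for j
  proof -
    have "Re (T k (\<Lambda> j)) \<le> 2 * closeness (\<Lambda> k) (\<Lambda> j)" if "k \<in> L j" for k
    proof -
      have k: "k \<in> J" "cmod (\<Lambda> j) \<le> cmod (\<Lambda> k)" using that by (auto simp: L_def)
      define x where "x = (cmod (\<Lambda> k))\<^sup>2"
      define y where "y = (cmod (\<Lambda> j))\<^sup>2"
      have xy: "y \<le> x" "0 \<le> y" "y \<le> 1"
        using k \<Lambda>[OF j] by (auto simp: x_def y_def abs_square_le_1 power_mono)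
      have "y * y \<le> x * y" using xy by (intro mult_right_mono) auto
      moreover have "(1 - y) * y \<le> 1 - y" using xy by (intro mult_left_le) auto
      \<comment> \<open>Here it matters that \<open>\<Lambda> k\<close> is at least as close to the circle as \<open>\<Lambda> j\<close>.\<close>
      ultimately have "1 - x * y \<le> 2 * (1 - y)" by (simp add: algebra_simps)
      then have "s k * (1 - x * y) / (cmod (1 - cnj (\<Lambda> k) * \<Lambda> j))\<^sup>2
          \<le> s k * (2 * (1 - y)) / (cmod (1 - cnj (\<Lambda> k) * \<Lambda> j))\<^sup>2"
        using s[OF k(1)] by (intro divide_right_mono mult_left_mono) auto
      then show ?thesis
        unfolding ReT[OF k(1) \<Lambda>[OF j]] closeness_formula[OF \<Lambda>[OF k(1)] \<Lambda>[OF j]] s_def[symmetric]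
        by (simp add: x_def y_def s_def algebra_simps)
    qed
    then have "Re (E j (\<Lambda> j)) \<le> (\<Sum>k\<in>L j. 2 * closeness (\<Lambda> k) (\<Lambda> j))"
      unfolding E_def Re_sum by (rule sum_mono)
    also have "\<dots> \<le> 2 * C"
      using sum[OF j L(2)] by (simp add: sum_distrib_left[symmetric])
    finally show ?thesis .
  qed
  have B_lower: "exp (- (C / \<epsilon>\<^sup>2)) \<le> cmod (B j (\<Lambda> j))" if j: "j \<in> J" for j
  proof -
    have fac: "exp (- (closeness (\<Lambda> k) (\<Lambda> j) / \<epsilon>\<^sup>2)) \<le> cmod (mobius (\<Lambda> k) (\<Lambda> j))" if "k \<in> J - {j}" for k
    proof -
      define r where "r = rho (\<Lambda> j) (\<Lambda> k)"
      have r: "\<epsilon> \<le> r" "r \<le> 1" "0 < r"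
        using sep[of j k] rho_lt_1[of "\<Lambda> j" "\<Lambda> k"] \<Lambda> j that \<epsilon> by (auto simp: r_def)
      have c: "closeness (\<Lambda> k) (\<Lambda> j) = 1 - r\<^sup>2"
        by (simp add: closeness_def r_def rho_commute)
      have "(1 - r\<^sup>2) / r\<^sup>2 \<le> (1 - r\<^sup>2) / \<epsilon>\<^sup>2"
        using r \<epsilon> by (intro divide_left_mono power_mono) (auto simp: abs_square_le_1)
      then have "1 / r\<^sup>2 \<le> 1 + (1 - r\<^sup>2) / \<epsilon>\<^sup>2"
        using r by (simp add: diff_divide_distrib)
      \<comment> \<open>Separation turns \<open>1 - c\<close> into at least \<open>exp (- c / \<epsilon>\<^sup>2)\<close> for a closeness \<open>c\<close>.\<close>
      also have "\<dots> \<le> exp ((1 - r\<^sup>2) / \<epsilon>\<^sup>2)" by (rule exp_ge_add_one_self)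
      finally have "exp (- ((1 - r\<^sup>2) / \<epsilon>\<^sup>2)) \<le> r\<^sup>2"
        using r by (simp add: exp_minus field_simps)
      also have "r\<^sup>2 \<le> r" using r by (simp add: power2_eq_square mult_left_le)
      finally show ?thesis by (simp add: c r_def rho_eq_cmod_mobius)
    qed
    have "(\<Sum>k\<in>J - {j}. closeness (\<Lambda> k) (\<Lambda> j)) \<le> C" by (rule sum[OF j]) auto
    then have "(\<Sum>k\<in>J - {j}. closeness (\<Lambda> k) (\<Lambda> j)) / \<epsilon>\<^sup>2 \<le> C / \<epsilon>\<^sup>2"
      by (rule divide_right_mono) simp
    then have "exp (- (C / \<epsilon>\<^sup>2)) \<le> exp (\<Sum>k\<in>J - {j}. - (closeness (\<Lambda> k) (\<Lambda> j) / \<epsilon>\<^sup>2))"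
      by (simp add: sum_negf sum_divide_distrib)
    also have "\<dots> = (\<Prod>k\<in>J - {j}. exp (- (closeness (\<Lambda> k) (\<Lambda> j) / \<epsilon>\<^sup>2)))"
      using J by (intro exp_sum) auto
    also have "\<dots> \<le> (\<Prod>k\<in>J - {j}. cmod (mobius (\<Lambda> k) (\<Lambda> j)))"
      using fac by (intro prod_mono) auto
    finally show ?thesis by (simp add: B_def prod_norm[symmetric])
  qed
  have B_nz: "B j (\<Lambda> j) \<noteq> 0" if "j \<in> J" for j
  proof -
    have "0 < cmod (B j (\<Lambda> j))"
      using less_le_trans[OF exp_gt_zero B_lower[OF that]] .
    then show ?thesis by simp
  qed
  have B_upper: "cmod (B j z) \<le> 1" if "cmod z < 1" for j z
    unfolding B_def prod_norm[symmetric]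
    using cmod_mobius_lt_1[OF \<Lambda> that] by (intro prod_le_1) (auto intro: less_imp_le)
  have F_bound: "cmod (F j z) \<le> exp (C / \<epsilon>\<^sup>2) * exp (2 * C) * (b j z * exp (- (\<Sum>k\<in>L j. b k z)))"
    if j: "j \<in> J" and z: "cmod z < 1" for j z
  proof -
    have 1: "cmod (B j z / B j (\<Lambda> j)) \<le> exp (C / \<epsilon>\<^sup>2)"
    proof -
      have "cmod (B j z / B j (\<Lambda> j)) \<le> 1 / exp (- (C / \<epsilon>\<^sup>2))"
        unfolding norm_divide using B_upper[OF z] B_lower[OF j] by (intro frac_le) auto
      then show ?thesis by (simp add: exp_minus divide_inverse)
    qed
    have 2: "cmod (P j z) = b j z"
      by (simp only: P_def b_def norm_divide norm_power power_divide norm_of_real abs_of_pos[OF s(1)[OF j]])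
    have 3: "cmod (exp (E j (\<Lambda> j) - E j z)) \<le> exp (2 * C) * exp (- (\<Sum>k\<in>L j. b k z))"
      using ReE_upper[OF j] ReE_lower[OF z, of j] by (simp add: norm_exp_eq_Re exp_add[symmetric])
    have "cmod (F j z) = cmod (B j z / B j (\<Lambda> j)) * b j z * cmod (exp (E j (\<Lambda> j) - E j z))"
      by (simp only: F_def norm_mult 2)
    also have "\<dots> \<le> exp (C / \<epsilon>\<^sup>2) * b j z * (exp (2 * C) * exp (- (\<Sum>k\<in>L j. b k z)))"
      by (intro mult_mono 1 3 mult_right_mono mult_nonneg_nonneg) (auto simp: b_def)
    finally show ?thesis by (simp add: ac_simps)
  qed
  define f where "f z = (\<Sum>j\<in>J. a j * F j z)" for z
  have "f holomorphic_on unit_disc"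
  proof -
    have "B j holomorphic_on unit_disc" for j
      unfolding B_def using \<Lambda> by (intro holomorphic_intros Moebius_function_holomorphic) auto
    moreover have "P j holomorphic_on unit_disc" if "j \<in> J" for j
      unfolding P_def using nz[OF that] by (intro holomorphic_intros) auto
    moreover have "T k holomorphic_on unit_disc" if "k \<in> J" for k
      unfolding T_def using nz[OF that] by (intro holomorphic_intros) auto
    then have "E j holomorphic_on unit_disc" for j
      unfolding E_def using L(2)[of j] by (intro holomorphic_intros) auto
    ultimately have "F j holomorphic_on unit_disc" if "j \<in> J" for j
      unfolding F_def using B_nz[OF that] that by (intro holomorphic_intros) auto
    then show ?thesis unfolding f_def by (intro holomorphic_intros) auto
  qed
  moreover have "cmod (f z) \<le> R * (exp (C / \<epsilon>\<^sup>2) * exp (2 * C))" if z: "cmod z < 1" for z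
  proof -
    have "cmod (f z) \<le> (\<Sum>j\<in>J. cmod (a j * F j z))"
      unfolding f_def by (rule norm_sum)
    also have "\<dots> \<le> (\<Sum>j\<in>J. R * (exp (C / \<epsilon>\<^sup>2) * exp (2 * C) * (b j z * exp (- (\<Sum>k\<in>L j. b k z)))))"
      unfolding norm_mult using a F_bound[OF _ z] by (intro sum_mono mult_mono) auto
    also have "\<dots> = R * (exp (C / \<epsilon>\<^sup>2) * exp (2 * C)) * (\<Sum>j\<in>J. b j z * exp (- (\<Sum>k\<in>L j. b k z)))"
      by (simp add: sum_distrib_left mult.assoc)
    also have "\<dots> \<le> R * (exp (C / \<epsilon>\<^sup>2) * exp (2 * C)) * 1"
    proof (rule mult_left_mono)
      have "(\<Sum>j\<in>J. b j z * exp (- (\<Sum>k\<in>L j. b k z))) \<le> 1 - exp (- (\<Sum>j\<in>J. b j z))"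
        unfolding L_def by (rule sum_exp_neg_tail_le[OF J]) (simp add: b_def)
      also have "\<dots> \<le> 1" by simp
      finally show "(\<Sum>j\<in>J. b j z * exp (- (\<Sum>k\<in>L j. b k z))) \<le> 1" .
    qed (use a in simp)
    finally show ?thesis by simp
  qed
  moreover have "f (\<Lambda> i) = a i" if i: "i \<in> J" for i
  proof -
    have "F j (\<Lambda> i) = of_bool (j = i)" if j: "j \<in> J" for j
    proof (cases "j = i")
      case True
      have "1 - cnj (\<Lambda> i) * \<Lambda> i = of_real (s i)"
        using complex_norm_square[of "\<Lambda> i"] by (simp add: s_def mult.commute)
      then have "P i (\<Lambda> i) = 1" using s[OF i] by (simp add: P_def)
      then show ?thesis using True B_nz[OF i] by (simp add: F_def)
    next
      case False
      then have "B j (\<Lambda> i) = 0"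
        using i J unfolding B_def by (intro prod_zero) (auto intro!: bexI[of _ i] simp: Moebius_function_eq_zero)
      then show ?thesis using False by (simp add: F_def)
    qed
    then have "f (\<Lambda> i) = (\<Sum>j\<in>J. a j * of_bool (j = i))"
      unfolding f_def by (intro sum.cong) auto
    also have "\<dots> = a i"
      using J i by (simp add: of_bool_def if_distrib cong: if_cong)
    finally show ?thesis .
  qed
  ultimately show ?thesis unfolding interpolates_def by blast
qed

lemma dispersed_imp_carleson_sequence:
  assumes "dispersed I \<Lambda>"
  shows "carleson_sequence I \<Lambda>"
proof -
  obtain \<epsilon> C where \<Lambda>: "\<Lambda> \<in> I \<rightarrow> unit_disc" and \<epsilon>: "\<epsilon> > 0"
    and sep: "\<forall>j\<in>I. \<forall>k\<in>I. j \<noteq> k \<longrightarrow> \<epsilon> \<le> rho (\<Lambda> j) (\<Lambda> k)"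
    and sum: "\<forall>k\<in>I. \<forall>J\<subseteq>I. finite J \<longrightarrow> (\<Sum>j\<in>J. closeness (\<Lambda> j) (\<Lambda> k)) \<le> C"
    using assms unfolding dispersed_def by (elim conjE exE) (rule that; assumption)
  have "\<exists>M. interpolates M I \<Lambda> a" if bd: "bounded (a ` I)" for a
  proof -
    obtain R where R: "\<And>j. j \<in> I \<Longrightarrow> cmod (a j) \<le> R" "0 < R"
      using bd unfolding bounded_pos by blast
    have "interpolates (R * (exp (C / \<epsilon>\<^sup>2) * exp (2 * C))) (I \<inter> {..<n}) \<Lambda> a" for n
    proof (rule interpolates_finite)
      show "(\<Sum>j\<in>J'. closeness (\<Lambda> j) (\<Lambda> k)) \<le> C" if "k \<in> I \<inter> {..<n}" "J' \<subseteq> I \<inter> {..<n}" for k J'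
      proof -
        have "J' \<subseteq> I" "finite J'" "k \<in> I"
          using that finite_subset[of J' "I \<inter> {..<n}"] by auto
        then show ?thesis using sum by simp
      qed
    qed (use \<Lambda> \<epsilon> sep R in \<open>auto intro: less_imp_le\<close>)
    then have "interpolates (R * (exp (C / \<epsilon>\<^sup>2) * exp (2 * C))) I \<Lambda> a"
      by (rule interpolates_limit[OF \<Lambda>])
    then show ?thesis ..
  qed
  then show ?thesis using \<Lambda> by (simp add: carleson_sequence_iff_interpolates)
qed

theorem carleson_sequence_iff_dispersed: "carleson_sequence I \<Lambda> \<longleftrightarrow> dispersed I \<Lambda>"
  using carleson_sequence_imp_dispersed dispersed_imp_carleson_sequence by blast


section \<open>Coarse bounds for maps that are uniform at one scale\<close>

lemma closeness_ge_of_rho_le_half: "rho z w \<le> 1 / 2 \<Longrightarrow> 3 / 4 \<le> closeness z w"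
  using power_mono[of "rho z w" "1 / 2" 2] rho_nonneg[of z w]
  by (simp add: closeness_def power2_eq_square)

text \<open>
  The hyperbolic segment from \<open>z\<close> to \<open>w\<close> is cut into \<open>m\<close> pieces of pseudohyperbolic length at most \<open>\<delta>\<close>,
  by shrinking \<open>w\<close> towards \<open>z\<close>: seen from \<open>z\<close>, each step divides the distance
  to the boundary by \<open>1 - \<delta>\<close>.
\<close>

lemma closeness_image_ge_power:
  assumes F: "\<And>z. cmod z < 1 \<Longrightarrow> cmod (F z) < 1" and \<delta>: "0 < \<delta>" "\<delta> < 1"
    and step: "\<And>z w. cmod z < 1 \<Longrightarrow> cmod w < 1 \<Longrightarrow> rho z w \<le> \<delta> \<Longrightarrow> rho (F z) (F w) \<le> 1 / 2"
    and z: "cmod z < 1"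
  shows "cmod w < 1 \<Longrightarrow> (1 - \<delta>) ^ m \<le> 1 - rho z w \<Longrightarrow> (3 / 16) ^ m \<le> closeness (F z) (F w)"
proof (induction m arbitrary: w)
  case 0
  then have "rho z w = 0" using rho_nonneg[of z w] by simp
  then have "z = w" using z 0 pseudohyperbolic.zero[of z w] by simp
  then show ?case by simp
next
  case (Suc m)
  define r where "r = 1 - \<delta>"
  define u where "u = mobius z w"
  have r: "0 < r" "r < 1" using \<delta> by (auto simp: r_def)
  have u: "cmod u = rho z w" "cmod u < 1"
    using rho_eq_cmod_mobius[of w z] cmod_mobius_lt_1[OF z Suc.prems(1)]
    by (auto simp: u_def rho_commute)
  show ?case
  proof (cases "cmod u \<le> \<delta>")
    case True
    then have "3 / 4 \<le> closeness (F z) (F w)"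
      using closeness_ge_of_rho_le_half step z Suc.prems u by simp
    moreover have "(3 / 16 :: real) ^ Suc m \<le> 3 / 16"
      using power_decreasing[of 1 "Suc m" "3 / 16 :: real"] by simp
    ultimately show ?thesis by linarith
  next
    case False
    define t where "t = 1 - (1 - cmod u) / r"
    have tr: "(1 - t) * r = 1 - cmod u" using r by (simp add: t_def)
    have t: "0 < t" "t < 1"
      using False u r by (auto simp: t_def r_def field_simps)
    have tu: "cmod u - t = \<delta> * (1 - t)"
      using tr by (simp add: r_def algebra_simps)
    define u' where "u' = of_real (t / cmod u) * u"
    have u0: "cmod u > 0" using False \<delta> by linarith
    have u': "cmod u' = t" using t u0 by (simp add: u'_def norm_mult norm_divide)
    have "u - u' = of_real (1 - t / cmod u) * u"
      by (simp add: u'_def algebra_simps)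
    then have "cmod (u' - u) = \<bar>1 - t / cmod u\<bar> * \<bar>cmod u\<bar>"
      by (simp only: norm_minus_commute[of u'] norm_mult norm_of_real abs_norm_cancel)
    also have "\<dots> = \<bar>(1 - t / cmod u) * cmod u\<bar>" by (rule abs_mult[symmetric])
    also have "(1 - t / cmod u) * cmod u = cmod u - t" using u0 by (simp add: left_diff_distrib)
    finally have d1: "cmod (u' - u) = \<bar>cmod u - t\<bar>" .
    have "cnj u' * u = of_real (t / cmod u) * (u * cnj u)"
      by (simp add: u'_def)
    also have "\<dots> = of_real (t * cmod u)"
      unfolding complex_norm_square[symmetric] using u0 by (simp add: power2_eq_square)
    finally have d2: "cmod (1 - cnj u' * u) = \<bar>1 - t * cmod u\<bar>"
      by (metis norm_of_real of_real_1 of_real_diff)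
    have tu1: "t * cmod u \<le> t" using t u by (intro mult_left_le) auto
    have "rho u' u \<le> \<delta>"
    proof -
      have "\<bar>cmod u - t\<bar> \<le> \<delta> * (1 - t * cmod u)"
        unfolding tu using t \<delta> tu1 by (simp add: abs_mult)
      moreover have pos: "0 < 1 - t * cmod u" using tu1 t by linarith
      ultimately show ?thesis
        unfolding rho_def norm_divide d1 d2 abs_of_pos[OF pos] pos_divide_le_eq[OF pos] by simp
    qed
    define w' where "w' = mobius (- z) u'"
    have w': "cmod w' < 1" "mobius z w' = u'"
      using cmod_mobius_lt_1[of "- z" u'] mobius_inverse(2)[OF z, of u'] z u' t by (auto simp: w'_def)
    have "rho z w' = t"
      using rho_eq_cmod_mobius[of w' z] w' u' by (simp add: rho_commute)
    moreover have "r * r ^ m \<le> r * (1 - t)"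
      using Suc.prems(2) u tr by (simp add: r_def[symmetric] mult.commute)
    then have "r ^ m \<le> 1 - t" using r by simp
    ultimately have "(3 / 16) ^ m \<le> closeness (F z) (F w')"
      by (intro Suc.IH[OF w'(1)]) (simp add: r_def)
    moreover have "rho w' w \<le> \<delta>"
      using rho_mobius[OF z w'(1) Suc.prems(1)] \<open>rho u' u \<le> \<delta>\<close> w'(2) by (simp add: u_def)
    then have "3 / 4 \<le> closeness (F w') (F w)"
      using closeness_ge_of_rho_le_half step w' Suc.prems by simp
    ultimately have "(3 / 16) ^ m * (3 / 4) \<le> closeness (F z) (F w') * closeness (F w') (F w)"
      using closeness_nonneg[OF F[OF z] F[OF w'(1)]] by (intro mult_mono) auto
    then show ?thesis
      using closeness_triangle[OF F[OF z] F[OF w'(1)] F[OF Suc.prems(1)]] by simp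
  qed
qed

text \<open>
  A hyperbolically large-scale Lipschitz bound, in multiplicative form. The number of pieces needed is
  logarithmic in the closeness, so the geometric bound of the previous lemma becomes a power
  law. The exponent is taken to be a natural number, which is harmless since closeness is at most 1.
\<close>

lemma closeness_image_ge:
  assumes F: "\<And>z. cmod z < 1 \<Longrightarrow> cmod (F z) < 1" and \<delta>: "0 < \<delta>" "\<delta> < 1"
    and step: "\<And>z w. cmod z < 1 \<Longrightarrow> cmod w < 1 \<Longrightarrow> rho z w \<le> \<delta> \<Longrightarrow> rho (F z) (F w) \<le> 1 / 2"
  obtains K n where "0 < K" "\<And>z w. cmod z < 1 \<Longrightarrow> cmod w < 1 \<Longrightarrow> K * closeness z w ^ n \<le> closeness (F z) (F w)"
proof -
  define r where "r = 1 - \<delta>"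
  have r: "0 < r" "r < 1" using \<delta> by (auto simp: r_def)
  \<comment> \<open>\<open>n\<close> steps of the subdivision shrink the source by as much as one step may shrink the image.\<close>
  obtain n where n: "r ^ n < 3 / 16"
    using real_arch_pow_inv[of "3 / 16" r] r by auto
  define K :: real where "K = (3 / 16) / 2 ^ n"
  have K: "0 < K" "K \<le> 1"
  proof -
    have "(1::real) \<le> 2 ^ n" by simp
    then have "3 \<le> 16 * (2::real) ^ n" by linarith
    then show "0 < K" "K \<le> 1" unfolding K_def by (auto simp: pos_divide_le_eq)
  qed
  have "K * closeness z w ^ n \<le> closeness (F z) (F w)" if z: "cmod z < 1" and w: "cmod w < 1" for z w
  proof -
    have lt: "rho z w < 1" using z w by (rule rho_lt_1)
    obtain m0 where "r ^ m0 < 1 - rho z w"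
      using real_arch_pow_inv[of "1 - rho z w" r] r lt by auto
    then have ex: "r ^ m0 \<le> 1 - rho z w" by simp
    define m where "m = (LEAST m. r ^ m \<le> 1 - rho z w)"
    have m: "r ^ m \<le> 1 - rho z w" unfolding m_def by (rule LeastI[of "\<lambda>m. r ^ m \<le> 1 - rho z w", OF ex])
    have low: "(3 / 16) ^ m \<le> closeness (F z) (F w)"
      using closeness_image_ge_power[OF F \<delta> step z w] m by (simp add: r_def)
    have c: "0 \<le> closeness z w" "closeness z w ^ n \<le> 1"
      using closeness_nonneg[OF z w] closeness_le_1 by (auto simp: power_le_one)
    show ?thesis
    proof (cases m)
      case 0
      have "K * closeness z w ^ n \<le> 1 * 1" using K c by (intro mult_mono) auto
      then show ?thesis using low 0 by simp
    next
      case (Suc p)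
      then have "\<not> r ^ p \<le> 1 - rho z w" unfolding m_def using not_less_Least by (metis lessI)
      moreover have "closeness z w \<le> 2 * (1 - rho z w)"
      proof -
        have "(1 - rho z w) * (1 + rho z w) \<le> (1 - rho z w) * 2" using lt by (intro mult_left_mono) auto
        then show ?thesis by (simp add: closeness_def power2_eq_square algebra_simps)
      qed
      ultimately have "closeness z w \<le> 2 * r ^ p" by simp
      then have "closeness z w ^ n \<le> (2 * r ^ p) ^ n" using c by (intro power_mono) auto
      also have "\<dots> = 2 ^ n * (r ^ n) ^ p" by (simp add: power_mult_distrib power_mult[symmetric] mult.commute)
      also have "\<dots> \<le> 2 ^ n * (3 / 16) ^ p" using n r by (intro mult_left_mono power_mono) auto
      finally have "K * closeness z w ^ n \<le> K * (2 ^ n * (3 / 16) ^ p)" using K by (intro mult_left_mono) auto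
      also have "\<dots> = (3 / 16) ^ m" by (simp add: K_def Suc)
      finally show ?thesis using low by simp
    qed
  qed
  then show thesis using that K by blast
qed

section \<open>Quasigeodesics pass near the origin\<close>

lemma sum_power_inj_le:
  fixes q :: real
  assumes "finite A" "inj_on f A" "0 \<le> q" "q < 1"
  shows "(\<Sum>k\<in>A. q ^ f k) \<le> 1 / (1 - q)"
proof -
  have "(\<Sum>k\<in>A. q ^ f k) = (\<Sum>j\<in>f ` A. q ^ j)"
    using assms by (simp add: sum.reindex)
  also have "\<dots> \<le> (\<Sum>j. q ^ j)"
    using assms by (intro sum_le_suminf summable_geometric) auto
  also have "\<dots> = 1 / (1 - q)"
    using assms by (intro suminf_geometric) auto
  finally show ?thesis .
qed

lemma sum_power_dist_le:
  fixes q :: real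
  assumes "finite J" "0 \<le> q" "q < 1"
  shows "(\<Sum>k\<in>J. q ^ nat \<bar>int k - int c\<bar>) \<le> 2 / (1 - q)"
proof -
  have "(\<Sum>k\<in>J. q ^ nat \<bar>int k - int c\<bar>) =
      (\<Sum>k\<in>J \<inter> {..c}. q ^ nat \<bar>int k - int c\<bar>) + (\<Sum>k\<in>J - {..c}. q ^ nat \<bar>int k - int c\<bar>)"
    using assms by (intro sum.Int_Diff) auto
  also have "\<dots> \<le> 1 / (1 - q) + 1 / (1 - q)"
    using assms by (intro add_mono sum_power_inj_le) (auto simp: inj_on_def)
  finally show ?thesis by simp
qed

text \<open>
  A step of bounded hyperbolic length has Euclidean length comparable to the distance to the circle. The constant
  \<open>1 / 2\<close> makes \<open>(rho p q)\<^sup>2 / closeness p q \<le> 1 / 3\<close>, which leaves room for the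
  arithmetic-geometric mean.
\<close>

lemma cmod_diff_le_of_rho_le_half:
  assumes p: "cmod p < 1" and q: "cmod q < 1" and "rho p q \<le> 1 / 2"
  shows "cmod (p - q) \<le> ((1 - (cmod p)\<^sup>2) + (1 - (cmod q)\<^sup>2)) / 2"
proof -
  define s where "s = 1 - (cmod p)\<^sup>2"
  define t where "t = 1 - (cmod q)\<^sup>2"
  have st: "0 < s" "0 < t" using one_minus_cmod_square_pos p q by (auto simp: s_def t_def)
  define D where "D = (cmod (1 - cnj p * q))\<^sup>2"
  have "cmod (1 - cnj p * q) > 0" using one_minus_cnj_mult_nonzero[OF p q] by simp
  then have D: "0 < D" by (simp add: D_def)
  have "3 / 4 \<le> s * t / D"
    using closeness_ge_of_rho_le_half[OF assms(3)] closeness_formula[OF p q] by (simp add: s_def t_def D_def)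
  then have "3 * D \<le> 4 * (s * t)" using D by (simp add: field_simps)
  moreover have "(rho p q)\<^sup>2 \<le> (1 / 2)\<^sup>2" using assms(3) rho_nonneg by (intro power_mono) auto
  then have "(rho p q)\<^sup>2 * D \<le> (1 / 2)\<^sup>2 * D" using D by (intro mult_right_mono) auto
  moreover have "(cmod (p - q))\<^sup>2 = (rho p q)\<^sup>2 * D"
    by (simp add: cmod_diff_le_rho[OF p q] power_mult_distrib D_def)
  moreover have "0 < s * t" using st by simp
  ultimately have "(cmod (p - q))\<^sup>2 \<le> s * t" unfolding power2_eq_square by linarith
  also have "\<dots> \<le> ((s + t) / 2)\<^sup>2"
    using zero_le_power2[of "s - t"] by (simp add: power2_eq_square field_simps)
  finally have "cmod (p - q) \<le> (s + t) / 2"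
    by (rule power2_le_imp_le) (use st in simp)
  then show ?thesis by (simp add: s_def t_def)
qed

text \<open>
  The addition theorem: \<open>tanh\<close> parametrises the diameter proportionally to hyperbolic length.
\<close>

lemma rho_diameter:
  fixes x y :: real
  assumes e: "cmod e = 1"
  shows "rho (of_real (tanh x) * e) (of_real (tanh y) * e) = \<bar>tanh (x - y)\<bar>"
proof -
  have ee: "cnj e * e = 1" using complex_norm_square[of e] e by (simp add: mult.commute)
  have "cnj (of_real (tanh x) * e) * (of_real (tanh y) * e) = of_real (tanh x * tanh y) * (cnj e * e)"
    by (simp add: ac_simps)
  then have 1: "1 - cnj (of_real (tanh x) * e) * (of_real (tanh y) * e) = of_real (1 - tanh x * tanh y)"
    by (simp add: ee)
  have 2: "of_real (tanh x) * e - of_real (tanh y) * e = of_real (tanh x - tanh y) * e"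
    by (simp add: left_diff_distrib)
  have "tanh (x - y) = (tanh x - tanh y) / (1 - tanh x * tanh y)"
    using tanh_add[of x "- y"] by simp
  then show ?thesis
    unfolding rho_def norm_divide 1 2 norm_mult norm_of_real e by (simp add: abs_divide)
qed

lemma one_minus_tanh_square_le: "1 - (tanh x)\<^sup>2 \<le> 4 * exp (- 2 * \<bar>x\<bar>)" for x :: real
proof -
  have c: "cosh x > 0" by simp
  have "exp \<bar>x\<bar> / 2 \<le> cosh \<bar>x\<bar>" by (simp add: cosh_def)
  then have "(exp \<bar>x\<bar> / 2)\<^sup>2 \<le> (cosh x)\<^sup>2" by (intro power_mono) auto
  moreover have "(exp \<bar>x\<bar> / 2)\<^sup>2 = exp (2 * \<bar>x\<bar>) / 4"
    by (simp add: power_divide exp_double)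
  ultimately have "1 / (cosh x)\<^sup>2 \<le> 4 / exp (2 * \<bar>x\<bar>)"
    using c by (simp add: field_simps)
  moreover have "1 - (tanh x)\<^sup>2 = 1 / (cosh x)\<^sup>2"
  proof -
    have "(tanh x)\<^sup>2 = ((cosh x)\<^sup>2 - 1) / (cosh x)\<^sup>2"
      by (simp add: tanh_def power_divide cosh_square_eq)
    then show ?thesis using c by (simp add: diff_divide_distrib)
  qed
  ultimately show ?thesis by (simp add: exp_minus divide_inverse)
qed


text \<open>
  This is the Morse lemma for quasigeodesics in the form needed here. Let \<open>x k\<close> be the images of
  equally spaced points on a diameter, far enough towards both ends. They join nearly antipodal points, so
  the sum of their steps is at least 1; a step at \<open>x k\<close> has length at most about
  \<open>s k = 1 - (cmod (x k))\<^sup>2\<close>. If \<open>s\<close> is maximal at \<open>c\<close>, with value \<open>m\<close>, then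
  \<open>s k ^ 2 / 4\<close> bounds the closeness of \<open>x k\<close> and \<open>x c\<close> from below, and this closeness decays geometrically in
  \<open>k - c\<close>. Since also \<open>s k \<le> m\<close>, a fixed fraction of the decay can be traded for a
  power of \<open>m\<close>, and \<open>1 \<le> sum s\<close> becomes a lower bound for \<open>m\<close>.
\<close>

lemma diameter_image_meets_compact:
  fixes \<delta> K :: real and n :: nat
  assumes \<delta>: "0 < \<delta>" "\<delta> < 1" and K: "0 < K"
  obtains \<eta> where "0 < \<eta>"
    "\<And>H e. \<lbrakk>\<And>z. cmod z < 1 \<Longrightarrow> cmod (H z) < 1;
      \<And>z w. cmod z < 1 \<Longrightarrow> cmod w < 1 \<Longrightarrow> rho z w \<le> \<delta> \<Longrightarrow> rho (H z) (H w) \<le> 1 / 2;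
      \<And>z w. cmod z < 1 \<Longrightarrow> cmod w < 1 \<Longrightarrow> K * closeness (H z) (H w) ^ n \<le> closeness z w;
      identity_boundary_values H; cmod e = 1\<rbrakk> \<Longrightarrow>
      \<exists>t. \<bar>t\<bar> < 1 \<and> \<eta> \<le> 1 - (cmod (H (of_real t * e)))\<^sup>2"
proof -
  \<comment> \<open>The spacing \<open>h = artanh \<delta>\<close> makes consecutive points exactly \<open>\<delta>\<close> apart.\<close>
  define a where "a = sqrt ((1 + \<delta>) / (1 - \<delta>))"
  define h where "h = ln a"
  have a: "0 < a" "a\<^sup>2 = (1 + \<delta>) / (1 - \<delta>)" using \<delta> by (auto simp: a_def)
  have h: "tanh h = \<delta>"
    unfolding h_def tanh_ln_real[OF a(1)] a(2) using \<delta> by (simp add: field_simps)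
  then have h0: "0 < h" using \<delta> by (metis tanh_real_pos_iff)
  define r where "r = exp (- 2 * h)"
  have r: "0 < r" "r < 1" using h0 by (auto simp: r_def)
  \<comment> \<open>\<open>s k ^ (2 * p)\<close> decays like \<open>r ^ d\<close> in the distance \<open>d\<close> of \<open>k\<close> from \<open>c\<close>; another factor \<open>s k ^ (2 * p)\<close>
    gives the maximum. Hence roots of order \<open>4 * p\<close>; the successor keeps the order positive.\<close>
  define p where "p = Suc n"
  define B where "B = 4 * 4 ^ p / K"
  have B: "0 < B" using K by (simp add: B_def)
  define q where "q = root (4 * p) r"
  have p0: "0 < 4 * p" by (simp add: p_def)
  have q: "0 \<le> q" "q < 1" "q ^ (4 * p) = r" using r p0 by (auto simp: q_def real_root_pow_pos2)
  define \<eta> where "\<eta> = ((1 - q) / 2) ^ (4 * p) / B"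
  have \<eta>: "0 < \<eta>" using q B by (simp add: \<eta>_def)
  have "\<exists>t. \<bar>t\<bar> < 1 \<and> \<eta> \<le> 1 - (cmod (H (of_real t * e)))\<^sup>2"
    if H: "\<And>z. cmod z < 1 \<Longrightarrow> cmod (H z) < 1"
      and step: "\<And>z w. cmod z < 1 \<Longrightarrow> cmod w < 1 \<Longrightarrow> rho z w \<le> \<delta> \<Longrightarrow> rho (H z) (H w) \<le> 1 / 2"
      and low: "\<And>z w. cmod z < 1 \<Longrightarrow> cmod w < 1 \<Longrightarrow> K * closeness (H z) (H w) ^ n \<le> closeness z w"
      and bv: "identity_boundary_values H" and e: "cmod e = 1" for H e
  proof -
    define y where "y x = of_real (tanh x) * e" for x
    have y: "cmod (y x) < 1" for x
      using e tanh_real_lt_1[of x] tanh_real_gt_neg1[of x] by (simp add: y_def norm_mult abs_less_iff)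
    obtain E where E: "continuous_on (cball 0 1) E" "\<And>z. cmod z < 1 \<Longrightarrow> E z = H z"
      "\<And>\<zeta>. cmod \<zeta> = 1 \<Longrightarrow> E \<zeta> = \<zeta>"
      using bv unfolding identity_boundary_values_def by auto
    have lim: "((\<lambda>x. H (y x)) \<longlongrightarrow> of_real c * e) F" if c: "\<bar>c\<bar> = 1" and "(tanh \<longlongrightarrow> c) F" for c F
    proof -
      have "((\<lambda>x. E (y x)) \<longlongrightarrow> E (of_real c * e)) F"
      proof (rule continuous_on_tendsto_compose[OF E(1)])
        show "(y \<longlongrightarrow> of_real c * e) F"
          unfolding y_def by (intro tendsto_intros that)
        show "of_real c * e \<in> cball 0 1" using c e by (simp add: norm_mult)
        show "\<forall>\<^sub>F x in F. y x \<in> cball 0 1" using y by (intro always_eventually) (auto intro: less_imp_le)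
      qed
      then show ?thesis using E(2)[OF y] E(3)[of "of_real c * e"] c e by (simp add: norm_mult)
    qed
    have "((\<lambda>x. H (y x)) \<longlongrightarrow> e) at_top"
      using lim[of 1 at_top] tanh_real_at_top by simp
    moreover have "((\<lambda>x. H (y x)) \<longlongrightarrow> - e) at_bot"
      using lim[of "- 1" at_bot] tanh_real_at_bot by simp
    then have "((\<lambda>x. H (y (- x))) \<longlongrightarrow> - e) at_top"
      by (simp add: filterlim_at_bot_mirror)
    ultimately have "((\<lambda>x. cmod (H (y x) - H (y (- x)))) \<longlongrightarrow> cmod (e - - e)) at_top"
      by (intro tendsto_intros)
    then have "\<forall>\<^sub>F x in at_top. 1 < cmod (H (y x) - H (y (- x)))"
      using e by (intro order_tendstoD(1)) (auto simp: norm_mult simp flip: mult_2)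
    then obtain x0 where x0: "\<And>x. x \<ge> x0 \<Longrightarrow> 1 < cmod (H (y x) - H (y (- x)))"
      unfolding eventually_at_top_linorder by blast
    obtain N :: nat where N: "x0 \<le> real N * h"
      using reals_Archimedean3[OF h0] less_imp_le by metis
    define t where "t k = (real k - real N) * h" for k
    define x where "x k = H (y (t k))" for k
    define s where "s k = 1 - (cmod (x k))\<^sup>2" for k
    have x: "cmod (x k) < 1" for k using H y by (simp add: x_def)
    have s: "0 < s k" "s k \<le> 1" for k using one_minus_cmod_square_pos[OF x] by (auto simp: s_def)
    have "1 < cmod (x (2 * N) - x 0)"
      using x0[OF N] by (simp add: x_def t_def)
    also have "\<dots> = cmod (\<Sum>k<2 * N. x (Suc k) - x k)"
      by (simp add: sum_lessThan_telescope)
    also have "\<dots> \<le> (\<Sum>k<2 * N. (s k + s (Suc k)) / 2)"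
    proof (rule sum_norm_le)
      fix k
      have "rho (y (t k)) (y (t (Suc k))) = \<bar>tanh (t k - t (Suc k))\<bar>"
        unfolding y_def by (rule rho_diameter[OF e])
      also have "t k - t (Suc k) = - h" by (simp add: t_def algebra_simps)
      finally have "rho (x k) (x (Suc k)) \<le> 1 / 2"
        unfolding x_def using step y h \<delta> by simp
      then show "cmod (x (Suc k) - x k) \<le> (s k + s (Suc k)) / 2"
        using cmod_diff_le_of_rho_le_half[OF x x] by (simp add: s_def norm_minus_commute)
    qed
    also have "\<dots> = ((\<Sum>k<2 * N. s k) + (\<Sum>k<2 * N. s (Suc k))) / 2"
      by (simp add: sum.distrib sum_divide_distrib[symmetric])
    also have "\<dots> \<le> (\<Sum>k\<le>2 * N. s k)"
    proof -
      have "(\<Sum>k<2 * N. s k) \<le> (\<Sum>k\<le>2 * N. s k)"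
        using s by (intro sum_mono2) (auto intro: less_imp_le)
      moreover have "(\<Sum>k<2 * N. s (Suc k)) \<le> (\<Sum>k\<le>2 * N. s k)"
        unfolding lessThan_Suc_atMost[symmetric] sum.lessThan_Suc_shift using s(1)[of 0] by simp
      ultimately show ?thesis by simp
    qed
    finally have sum_s: "1 < (\<Sum>k\<le>2 * N. s k)" .
    have "Max (s ` {..2 * N}) \<in> s ` {..2 * N}" by (intro Max_in) auto
    then obtain c where "c \<in> {..2 * N}" and c: "Max (s ` {..2 * N}) = s c" by (rule imageE)
    have max: "s k \<le> s c" if "k \<le> 2 * N" for k
      unfolding c[symmetric] using that by (intro Max_ge) auto
    have decay: "s k ^ (4 * p) \<le> s c * B * r ^ nat \<bar>int k - int c\<bar>" if k: "k \<le> 2 * N" for k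
    proof -
      let ?d = "nat \<bar>int k - int c\<bar>"
      have cl: "(s k)\<^sup>2 / 4 \<le> closeness (x k) (x c)"
      proof -
        have "(s k)\<^sup>2 \<le> s k * s c"
          unfolding power2_eq_square using max[OF k] s(1)[of k] by (intro mult_left_mono) auto
        then show ?thesis
          using closeness_triangle[OF x[of k], of 0, OF _ x[of c]] by (simp add: closeness_0 s_def)
      qed
      have "K * ((s k)\<^sup>2 / 4) ^ p \<le> K * ((s k)\<^sup>2 / 4) ^ n"
        using s[of k] K unfolding p_def
        by (intro mult_left_mono power_decreasing) (auto simp: power_le_one intro: order_trans[of _ 1])
      also have "\<dots> \<le> K * closeness (x k) (x c) ^ n"
        using cl K by (intro mult_left_mono power_mono) auto
      also have "\<dots> \<le> closeness (y (t k)) (y (t c))"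
        unfolding x_def by (rule low[OF y y])
      also have "\<dots> = 1 - (tanh (t k - t c))\<^sup>2"
        unfolding closeness_def y_def rho_diameter[OF e] by simp
      also have "\<dots> \<le> 4 * exp (- 2 * \<bar>t k - t c\<bar>)"
        by (rule one_minus_tanh_square_le)
      also have "exp (- 2 * \<bar>t k - t c\<bar>) = r ^ ?d"
      proof -
        have "t k - t c = (real k - real c) * h" by (simp add: t_def algebra_simps)
        moreover have "real ?d = \<bar>real k - real c\<bar>" by (simp add: nat_eq_iff)
        ultimately have "- 2 * \<bar>t k - t c\<bar> = real ?d * (- 2 * h)"
          using h0 by (simp add: abs_mult)
        then show ?thesis by (simp only: r_def exp_of_nat_mult)
      qed
      finally have "s k ^ (2 * p) \<le> B * r ^ ?d"
        using K by (simp add: B_def power_divide power_mult[symmetric] field_simps)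
      moreover have "s k ^ (2 * p) \<le> s c"
      proof -
        have "s k ^ (2 * p) \<le> s k ^ 1" using s[of k] by (intro power_decreasing) (auto simp: p_def)
        then show ?thesis using max[OF k] by simp
      qed
      ultimately have "s k ^ (2 * p) * s k ^ (2 * p) \<le> s c * (B * r ^ ?d)"
        using s by (intro mult_mono) (auto intro: less_imp_le)
      then show ?thesis by (simp add: power_add[symmetric] mult.assoc)
    qed
    define R where "R = root (4 * p) (s c * B)"
    have R: "0 \<le> R" "R ^ (4 * p) = s c * B"
      using s(1)[of c] B p0 by (auto simp: R_def real_root_pow_pos2)
    have bound: "s k \<le> R * q ^ nat \<bar>int k - int c\<bar>" if "k \<le> 2 * N" for k
    proof (rule power_le_imp_le_base)
      have "s k ^ Suc (4 * p - 1) \<le> s c * B * r ^ nat \<bar>int k - int c\<bar>"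
        using decay[OF that] p0 by simp
      also have "\<dots> = (R * q ^ nat \<bar>int k - int c\<bar>) ^ (4 * p)"
      proof -
        have "(q ^ nat \<bar>int k - int c\<bar>) ^ (4 * p) = r ^ nat \<bar>int k - int c\<bar>"
          by (metis power_mult mult.commute q(3))
        then show ?thesis by (simp only: power_mult_distrib R(2))
      qed
      finally show "s k ^ Suc (4 * p - 1) \<le> (R * q ^ nat \<bar>int k - int c\<bar>) ^ Suc (4 * p - 1)"
        using p0 by simp
    qed (use R q in simp)
    have "1 < R * (\<Sum>k\<le>2 * N. q ^ nat \<bar>int k - int c\<bar>)"
      using sum_s sum_mono[of "{..2 * N}" s, OF bound] by (simp add: sum_distrib_left)
    also have "\<dots> \<le> R * (2 / (1 - q))"
      using R q by (intro mult_left_mono sum_power_dist_le) auto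
    finally have "(1 - q) / 2 \<le> R"
      using q by (simp add: field_simps)
    then have "((1 - q) / 2) ^ (4 * p) \<le> s c * B"
      unfolding R(2)[symmetric] using q by (intro power_mono) auto
    then have "\<eta> \<le> s c"
      using B by (simp add: \<eta>_def pos_divide_le_eq)
    moreover have "\<bar>tanh (t c)\<bar> < 1"
      using tanh_real_lt_1[of "t c"] tanh_real_gt_neg1[of "t c"] by (simp add: abs_less_iff)
    ultimately show ?thesis
      by (intro exI[of _ "tanh (t c)"]) (simp add: s_def x_def y_def)
  qed
  then show thesis using that \<eta> by blast
qed


section \<open>Moebius conjugation on the closed disc\<close>

lemma one_minus_cnj_mult_nonzero_closed:
  assumes "cmod a < 1" "cmod z \<le> 1"
  shows "1 - cnj a * z \<noteq> 0"
proof
  assume "1 - cnj a * z = 0"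
  then have "cmod (cnj a * z) = 1" by (metis eq_iff_diff_eq_0 norm_one)
  moreover have "cmod (cnj a * z) \<le> cmod a"
    using assms mult_left_le[of "cmod z" "cmod a"] by (simp add: norm_mult)
  ultimately show False using assms by linarith
qed

lemma cmod_mobius_circle:
  assumes a: "cmod a < 1" and z: "cmod z = 1"
  shows "cmod (mobius a z) = 1"
proof -
  have "(cmod (a - z))\<^sup>2 = (cmod (1 - cnj a * z))\<^sup>2"
    using cmod_diff_square[of a z] z by simp
  then have "cmod (z - a) = cmod (1 - cnj a * z)"
    by (simp add: norm_minus_commute)
  then show ?thesis
    using one_minus_cnj_mult_nonzero_closed[OF a] z by (simp add: Moebius_function_simple norm_divide)
qed

lemma mobius_inverse_closed:
  assumes a: "cmod a < 1" and z: "cmod z \<le> 1"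
  shows "mobius a (mobius (- a) z) = z"
proof -
  have nz: "1 + cnj a * z \<noteq> 0" "1 - cnj a * a \<noteq> 0"
    using one_minus_cnj_mult_nonzero_closed[of "- a" z] one_minus_cnj_mult_nonzero_closed[of a a] a z by auto
  define d where "d = 1 + cnj a * z"
  define k where "k = 1 - cnj a * a"
  have w: "mobius (- a) z = (z + a) / d" by (simp add: Moebius_function_simple d_def)
  have "(z + a) / d - a = ((z + a) - a * d) / d" "1 - cnj a * ((z + a) / d) = (d - cnj a * (z + a)) / d"
    using nz by (simp_all add: d_def[symmetric] diff_divide_distrib)
  moreover have "(z + a) - a * d = z * k" "d - cnj a * (z + a) = k"
    by (simp_all add: d_def k_def algebra_simps)
  ultimately have "mobius a (mobius (- a) z) = (z * k / d) / (k / d)"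
    by (subst w, subst Moebius_function_simple) (simp only:)
  then show ?thesis using nz by (simp add: d_def[symmetric] k_def[symmetric])
qed

lemma continuous_on_mobius:
  assumes "cmod a < 1"
  shows "continuous_on (cball 0 1) (mobius a)"
  unfolding Moebius_function_simple using one_minus_cnj_mult_nonzero_closed[OF assms]
  by (intro continuous_intros) auto

lemma mobius_maps_closed_disc:
  assumes a: "cmod a < 1" and z: "cmod z \<le> 1"
  shows "cmod (mobius a z) \<le> 1"
  using cmod_mobius_lt_1[OF a, of z] cmod_mobius_circle[OF a, of z] z by (cases "cmod z = 1") auto

lemma identity_boundary_values_conjugate:
  assumes a: "cmod a < 1" and H: "identity_boundary_values F" and F: "\<And>z. cmod z < 1 \<Longrightarrow> cmod (F z) < 1"
  shows "identity_boundary_values (\<lambda>z. mobius a (F (mobius (- a) z)))"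
proof -
  obtain E where E: "continuous_on (cball 0 1) E" "\<forall>z\<in>unit_disc. E z = F z" "\<forall>\<zeta>\<in>unit_circle. E \<zeta> = \<zeta>"
    using H unfolding identity_boundary_values_def by blast
  have a': "cmod (- a) < 1" using a by simp
  have Emap: "cmod (E z) \<le> 1" if "cmod z \<le> 1" for z
    using that E(2,3) F[of z] by (cases "cmod z = 1") auto
  have "continuous_on (cball 0 1) (\<lambda>z. E (mobius (- a) z))"
    by (rule continuous_on_compose2[OF E(1) continuous_on_mobius[OF a']])
       (use mobius_maps_closed_disc[OF a'] in auto)
  then have "continuous_on (cball 0 1) (\<lambda>z. mobius a (E (mobius (- a) z)))"
    by (rule continuous_on_compose2[OF continuous_on_mobius[OF a]])
       (use mobius_maps_closed_disc[OF a'] Emap in auto)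
  moreover have "mobius a (E (mobius (- a) \<zeta>)) = \<zeta>" if "cmod \<zeta> = 1" for \<zeta>
    using E(3) cmod_mobius_circle[OF a' that] mobius_inverse_closed[OF a, of \<zeta>] that by simp
  moreover have "E (mobius (- a) z) = F (mobius (- a) z)" if "cmod z < 1" for z
    using E(2) cmod_mobius_lt_1[OF a' that] by simp
  ultimately show ?thesis
    unfolding identity_boundary_values_def
    by (intro exI[of _ "\<lambda>z. mobius a (E (mobius (- a) z))"]) auto
qed

section \<open>Bounded displacement\<close>

text \<open>
  By conjugation it is enough to bound the displacement of the origin. The images of two perpendicular
  diameters both come within bounded distance of the origin, hence of each other, so the two
  preimages are within bounded distance of each other. Points on perpendicular diameters are at least
  as far from each other as from the origin; so one preimage, and with it its image, is
  within bounded distance of the origin and of the image of the origin.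
\<close>

lemma bounded_displacement:
  assumes F: "\<And>z. cmod z < 1 \<Longrightarrow> cmod (F z) < 1" and G: "\<And>z. cmod z < 1 \<Longrightarrow> cmod (G z) < 1"
    and GF: "\<And>z. cmod z < 1 \<Longrightarrow> G (F z) = z"
    and \<delta>: "0 < \<delta>" "\<delta> < 1"
    and stepF: "\<And>z w. cmod z < 1 \<Longrightarrow> cmod w < 1 \<Longrightarrow> rho z w \<le> \<delta> \<Longrightarrow> rho (F z) (F w) \<le> 1 / 2"
    and stepG: "\<And>z w. cmod z < 1 \<Longrightarrow> cmod w < 1 \<Longrightarrow> rho z w \<le> \<delta> \<Longrightarrow> rho (G z) (G w) \<le> 1 / 2"
    and bv: "identity_boundary_values F"
  obtains \<eta> where "0 < \<eta>" "\<And>z. cmod z < 1 \<Longrightarrow> \<eta> \<le> closeness (F z) z"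
proof -
  obtain K n where K: "0 < K"
    and lowG: "\<And>z w. cmod z < 1 \<Longrightarrow> cmod w < 1 \<Longrightarrow> K * closeness z w ^ n \<le> closeness (G z) (G w)"
    using closeness_image_ge[of G \<delta>, OF G \<delta> stepG] by blast
  obtain K' n' where K': "0 < K'"
    and lowF: "\<And>z w. cmod z < 1 \<Longrightarrow> cmod w < 1 \<Longrightarrow> K' * closeness z w ^ n' \<le> closeness (F z) (F w)"
    using closeness_image_ge[of F \<delta>, OF F \<delta> stepF] by blast
  obtain \<eta> where \<eta>: "0 < \<eta>" and meets: "\<And>H e. \<lbrakk>\<And>z. cmod z < 1 \<Longrightarrow> cmod (H z) < 1;
      \<And>z w. cmod z < 1 \<Longrightarrow> cmod w < 1 \<Longrightarrow> rho z w \<le> \<delta> \<Longrightarrow> rho (H z) (H w) \<le> 1 / 2;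
      \<And>z w. cmod z < 1 \<Longrightarrow> cmod w < 1 \<Longrightarrow> K * closeness (H z) (H w) ^ n \<le> closeness z w;
      identity_boundary_values H; cmod e = 1\<rbrakk> \<Longrightarrow>
      \<exists>t. \<bar>t\<bar> < 1 \<and> \<eta> \<le> 1 - (cmod (H (of_real t * e)))\<^sup>2"
    using diameter_image_meets_compact[OF \<delta> K, where n = n] by blast
  define \<eta>1 where "\<eta>1 = K * (\<eta> * \<eta> / 4) ^ n"
  define \<eta>2 where "\<eta>2 = K' * \<eta>1 ^ n'"
  have pos: "0 < \<eta>1" "0 < \<eta>2" using K K' \<eta> by (auto simp: \<eta>1_def \<eta>2_def)
  have "\<eta>2 * \<eta> / 4 \<le> closeness (F b) b" if b: "cmod b < 1" for b
  proof -
    define H where "H z = mobius b (F (mobius (- b) z))" for z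
    have b': "cmod (- b) < 1" using b by simp
    note mb = cmod_mobius_lt_1[OF b'] 
    have H: "cmod (H z) < 1" if "cmod z < 1" for z
      using cmod_mobius_lt_1[OF b F[OF mb[OF that]]] by (simp add: H_def)
    have clH: "closeness (H z) (H w) = closeness (F (mobius (- b) z)) (F (mobius (- b) w))"
      if "cmod z < 1" "cmod w < 1" for z w
      unfolding H_def by (rule closeness_mobius[OF b F[OF mb[OF that(1)]] F[OF mb[OF that(2)]]])
    have stepH: "rho (H z) (H w) \<le> 1 / 2" if "cmod z < 1" "cmod w < 1" "rho z w \<le> \<delta>" for z w
      unfolding H_def rho_mobius[OF b F[OF mb[OF that(1)]] F[OF mb[OF that(2)]]]
      by (rule stepF[OF mb[OF that(1)] mb[OF that(2)]]) (simp add: rho_mobius[OF b' that(1,2)] that(3))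
    have lowGH: "K * closeness (H z) (H w) ^ n \<le> closeness z w" if "cmod z < 1" "cmod w < 1" for z w
      using lowG[OF F[OF mb[OF that(1)]] F[OF mb[OF that(2)]]] GF[OF mb[OF that(1)]] GF[OF mb[OF that(2)]]
      by (simp add: clH[OF that] closeness_mobius[OF b' that])
    have lowFH: "K' * closeness z w ^ n' \<le> closeness (H z) (H w)" if "cmod z < 1" "cmod w < 1" for z w
      using lowF[OF mb[OF that(1)] mb[OF that(2)]] by (simp add: clH[OF that] closeness_mobius[OF b' that])
    have bvH: "identity_boundary_values H"
      unfolding H_def by (rule identity_boundary_values_conjugate[OF b bv F])
    obtain s where s: "\<bar>s\<bar> < 1" "\<eta> \<le> 1 - (cmod (H (of_real s * 1)))\<^sup>2"
      using meets[of H 1, OF H stepH lowGH bvH] by auto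
    obtain t where t: "\<bar>t\<bar> < 1" "\<eta> \<le> 1 - (cmod (H (of_real t * \<i>)))\<^sup>2"
      using meets[of H \<i>, OF H stepH lowGH bvH] by auto
    define p where "p = complex_of_real s"
    define q where "q = complex_of_real t * \<i>"
    have p: "cmod p < 1" and q: "cmod q < 1" using s t by (auto simp: p_def q_def norm_mult)
    have Hp: "\<eta> \<le> closeness (H p) 0" and Hq: "\<eta> \<le> closeness 0 (H q)"
      using s(2) t(2) by (simp_all add: closeness_0 p_def q_def)
    have z: "cmod (0::complex) < 1" by simp
    have "\<eta> * \<eta> \<le> closeness (H p) 0 * closeness 0 (H q)"
      using Hp Hq \<eta> by (intro mult_mono) auto
    then have "\<eta> * \<eta> / 4 \<le> closeness (H p) (H q)"
      using closeness_triangle[OF H[OF p] z H[OF q]] by linarith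
    then have "\<eta>1 \<le> K * closeness (H p) (H q) ^ n"
      unfolding \<eta>1_def using K \<eta> by (intro mult_left_mono power_mono) auto
    also have "\<dots> \<le> closeness p q" by (rule lowGH[OF p q])
    \<comment> \<open>Perpendicularity: \<open>cnj p * q\<close> is imaginary, so the denominator is at least 1.\<close>
    also have "\<dots> \<le> closeness p 0"
    proof -
      have "(cmod (1 - cnj p * q))\<^sup>2 = 1 + (s * t)\<^sup>2"
        unfolding cmod_power2 by (simp add: p_def q_def)
      then have "1 - (cmod q)\<^sup>2 \<le> (cmod (1 - cnj p * q))\<^sup>2"
        using zero_le_power2[of "s * t"] zero_le_power2[of "cmod q"] by linarith
      moreover have "0 < cmod (1 - cnj p * q)" using one_minus_cnj_mult_nonzero[OF p q] by simp
      ultimately have "(1 - (cmod q)\<^sup>2) / (cmod (1 - cnj p * q))\<^sup>2 \<le> 1" by simp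
      then have "(1 - (cmod p)\<^sup>2) * ((1 - (cmod q)\<^sup>2) / (cmod (1 - cnj p * q))\<^sup>2) \<le> 1 - (cmod p)\<^sup>2"
        using one_minus_cmod_square_pos[OF p] by (intro mult_left_le) auto
      then show ?thesis by (simp add: closeness_formula[OF p q] closeness_0)
    qed
    finally have "\<eta>2 \<le> K' * closeness p 0 ^ n'"
      unfolding \<eta>2_def using K' pos by (intro mult_left_mono power_mono) auto
    also have "\<dots> \<le> closeness (H 0) (H p)" using lowFH[OF p z] by (simp add: closeness_commute)
    finally have "\<eta>2 * \<eta> \<le> closeness (H 0) (H p) * closeness (H p) 0"
      using Hp \<eta> pos by (intro mult_mono) auto
    then have "\<eta>2 * \<eta> / 4 \<le> closeness (H 0) 0"
      using closeness_triangle[OF H[OF z] H[OF p] z] by linarith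
    moreover have "closeness (H 0) 0 = closeness (F b) b"
    proof -
      have "H 0 = mobius b (F b)" by (simp add: H_def Moebius_function_of_zero)
      moreover have "0 = mobius b b" by (simp add: Moebius_function_eq_zero)
      ultimately show ?thesis using closeness_mobius[OF b F[OF b] b] by (simp only:)
    qed
    ultimately show ?thesis by simp
  qed
  then show thesis using that[of "\<eta>2 * \<eta> / 4"] pos \<eta> by simp
qed

text \<open>
  Bounded hyperbolic displacement means small Euclidean displacement near the circle.
\<close>

lemma continuous_on_extend_by_id:
  assumes F: "\<And>z. cmod z < 1 \<Longrightarrow> cmod (F z) < 1" and cont: "continuous_on unit_disc F"
    and \<eta>: "0 < \<eta>" "\<And>z. cmod z < 1 \<Longrightarrow> \<eta> \<le> closeness (F z) z"
  shows "continuous_on (cball 0 1) (\<lambda>z. if cmod z < 1 then F z else z)" (is "continuous_on _ ?E")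
proof -
  have bound: "cmod (?E z - z) \<le> sqrt ((1 - (cmod z)\<^sup>2) / \<eta>)" if "cmod z \<le> 1" for z
  proof (cases "cmod z < 1")
    case True
    define D where "D = (cmod (1 - cnj (F z) * z))\<^sup>2"
    have D: "0 < D" using one_minus_cnj_mult_nonzero[OF F[OF True] True] by (simp add: D_def)
    define s where "s = (1 - (cmod (F z))\<^sup>2) * (1 - (cmod z)\<^sup>2)"
    have "\<eta> \<le> s / D" using \<eta>(2)[OF True] closeness_formula[OF F[OF True] True] by (simp add: s_def D_def)
    then have "D \<le> s / \<eta>" using D \<eta>(1) by (simp add: field_simps)
    moreover have "s \<le> 1 - (cmod z)\<^sup>2"
      using one_minus_cmod_square_pos[OF True] unfolding s_def by (simp add: mult_left_le_one_le)
    then have "s / \<eta> \<le> (1 - (cmod z)\<^sup>2) / \<eta>" using \<eta>(1) by (simp add: divide_right_mono)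
    moreover have "(cmod (F z - z))\<^sup>2 \<le> D"
    proof -
      have "(rho (F z) z)\<^sup>2 \<le> 1" using rho_lt_1[OF F[OF True] True] rho_nonneg[of "F z" z]
        by (simp add: abs_square_le_1)
      then show ?thesis
        using D by (simp add: cmod_diff_le_rho[OF F[OF True] True] power_mult_distrib D_def mult_left_le_one_le)
    qed
    ultimately have "(cmod (F z - z))\<^sup>2 \<le> (1 - (cmod z)\<^sup>2) / \<eta>" by linarith
    then show ?thesis using True by (simp add: real_le_rsqrt)
  next
    case False
    then show ?thesis using \<eta> that by simp
  qed
  show ?thesis
    unfolding continuous_on_def
  proof
    fix \<zeta> :: complex assume "\<zeta> \<in> cball 0 1"
    then consider "cmod \<zeta> < 1" | "cmod \<zeta> = 1" by fastforce
    then show "(?E \<longlongrightarrow> ?E \<zeta>) (at \<zeta> within cball 0 1)"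
    proof cases
      case 1
      then have "isCont F \<zeta>"
        using cont continuous_on_eq_continuous_at[of unit_disc F] by simp
      then have "(F \<longlongrightarrow> ?E \<zeta>) (at \<zeta>)" using 1 by (simp add: isCont_def)
      moreover have "\<forall>\<^sub>F z in at \<zeta>. F z = ?E z"
      proof -
        have "\<forall>\<^sub>F z in at \<zeta>. z \<in> unit_disc"
          using 1 by (intro eventually_at_in_open') auto
        then show ?thesis by eventually_elim auto
      qed
      ultimately have "(?E \<longlongrightarrow> ?E \<zeta>) (at \<zeta>)" by (rule Lim_transform_eventually)
      then show ?thesis by (rule tendsto_within_subset) simp
    next
      case 2
      have "((\<lambda>z. sqrt ((1 - (cmod z)\<^sup>2) / \<eta>)) \<longlongrightarrow> sqrt ((1 - (cmod \<zeta>)\<^sup>2) / \<eta>)) (at \<zeta> within cball 0 1)"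
        using \<eta> by (intro tendsto_intros) auto
      then have "((\<lambda>z. sqrt ((1 - (cmod z)\<^sup>2) / \<eta>)) \<longlongrightarrow> 0) (at \<zeta> within cball 0 1)"
        using 2 by simp
      then have "((\<lambda>z. ?E z - z) \<longlongrightarrow> 0) (at \<zeta> within cball 0 1)"
        by (rule Lim_null_comparison[rotated]) (use bound in \<open>auto simp: eventually_at_topological\<close>)
      then have "((\<lambda>z. (?E z - z) + z) \<longlongrightarrow> 0 + \<zeta>) (at \<zeta> within cball 0 1)"
        by (intro tendsto_intros)
      then show ?thesis using 2 by simp
    qed
  qed
qed


section \<open>Sparse sequences of pairs\<close>

lemma closeness_le_of_nearer_boundary:
  assumes x: "cmod x < 1" and y: "cmod y < 1"
  shows "closeness x y \<le> 4 * ((1 - cmod x) / (1 - cmod y))"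
proof -
  define D where "D = cmod (1 - cnj x * y)"
  have "1 - cmod y \<le> 1 - cmod x * cmod y"
    using x mult_left_le_one_le[of "cmod y" "cmod x"] by simp
  also have "\<dots> \<le> D"
    using norm_triangle_ineq2[of 1 "cnj x * y"] by (simp add: norm_mult D_def)
  finally have D: "1 - cmod y \<le> D" .
  then have D2: "(1 - cmod y)\<^sup>2 \<le> D\<^sup>2" using y by (intro power_mono) auto
  have two: "1 - (cmod u)\<^sup>2 \<le> 2 * (1 - cmod u)" if "cmod u < 1" for u
  proof -
    have "(1 - cmod u) * (1 + cmod u) \<le> (1 - cmod u) * 2" using that by (intro mult_left_mono) auto
    then show ?thesis by (simp add: power2_eq_square algebra_simps)
  qed
  have "closeness x y = (1 - (cmod x)\<^sup>2) * (1 - (cmod y)\<^sup>2) / D\<^sup>2"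
    using closeness_formula[OF x y] by (simp add: D_def)
  also have "\<dots> \<le> (2 * (1 - cmod x)) * (2 * (1 - cmod y)) / (1 - cmod y)\<^sup>2"
    using two[OF x] two[OF y] one_minus_cmod_square_pos[OF x] one_minus_cmod_square_pos[OF y] x y D2
    by (intro frac_le mult_mono) auto
  also have "\<dots> = 4 * ((1 - cmod x) / (1 - cmod y))"
  proof -
    have *: "(2 * a) * (2 * b) / b\<^sup>2 = 4 * (a / b)" if "0 < b" for a b :: real
      using that by (simp add: power2_eq_square)
    show ?thesis by (rule *) (use y in simp)
  qed
  finally show ?thesis .
qed

definition interleave :: "(nat \<Rightarrow> 'a) \<Rightarrow> (nat \<Rightarrow> 'a) \<Rightarrow> nat \<Rightarrow> 'a" where
  "interleave p q k = (if even k then p (k div 2) else q (k div 2))"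

lemma interleave_cases: "interleave p q k = p (k div 2) \<or> interleave p q k = q (k div 2)"
  by (simp add: interleave_def)

text \<open>
  If every pair is at least 16 times closer to the circle than all earlier ones, the closeness of points in
  different pairs decays geometrically in the difference of their positions; within a pair the
  separation is assumed.
\<close>

lemma sparse_subsequence_carleson:
  assumes p: "\<And>n. cmod (p n) < 1" "(\<lambda>n. cmod (p n)) \<longlonglongrightarrow> 1"
    and q: "\<And>n. cmod (q n) < 1" "(\<lambda>n. cmod (q n)) \<longlonglongrightarrow> 1"
    and \<epsilon>: "0 < \<epsilon>" "\<And>n. \<epsilon> \<le> rho (p n) (q n)"
  obtains r :: "nat \<Rightarrow> nat" where "strict_mono r" "carleson_sequence UNIV (interleave (p \<circ> r) (q \<circ> r))"
proof -
  define t where "t n = max (1 - cmod (p n)) (1 - cmod (q n))" for n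
  define s where "s n = min (1 - cmod (p n)) (1 - cmod (q n))" for n
  have s: "0 < s n" for n using p(1) q(1) by (simp add: s_def)
  have "t \<longlonglongrightarrow> max (1 - 1) (1 - 1)"
    unfolding t_def by (intro tendsto_intros p q)
  then have t0: "t \<longlonglongrightarrow> 0" by simp
  have "\<exists>r :: nat \<Rightarrow> nat. \<forall>n. True \<and> (r n < r (Suc n) \<and> t (r (Suc n)) \<le> s (r n) / 16)"
  proof (rule dependent_nat_choice)
    fix x n :: nat
    have "\<forall>\<^sub>F m in sequentially. t m < s x / 16"
      using s by (intro order_tendstoD(2)[OF t0]) simp
    then obtain N where N: "\<And>m. m \<ge> N \<Longrightarrow> t m < s x / 16"
      unfolding eventually_sequentially by blast
    have "t (max N (Suc x)) \<le> s x / 16" using N[of "max N (Suc x)"] by simp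
    moreover have "x < max N (Suc x)" by simp
    ultimately show "\<exists>y. True \<and> (x < y \<and> t y \<le> s x / 16)" by blast
  qed simp
  then obtain r where r: "\<And>n. r n < r (Suc n)" "\<And>n. t (r (Suc n)) \<le> s (r n) / 16" by blast
  have mono: "strict_mono r" using r(1) by (simp add: strict_mono_Suc_iff)
  have st: "s n \<le> t n" for n by (simp add: s_def t_def)
  have geom: "t (r n) \<le> s (r m) * (1 / 16) ^ (n - m)" if mn: "m < n" for m n
  proof -
    have "t (r (m + Suc d)) \<le> s (r m) * (1 / 16) ^ Suc d" for d
    proof (induction d)
      case 0
      then show ?case using r(2)[of m] by simp
    next
      case (Suc d)
      then show ?case using r(2)[of "m + Suc d"] st[of "r (m + Suc d)"] by simp
    qed
    moreover obtain d where "n = Suc (m + d)" using less_imp_Suc_add[OF mn] by blast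
    ultimately show ?thesis by simp
  qed
  define \<Lambda> where "\<Lambda> = interleave (p \<circ> r) (q \<circ> r)"
  have \<Lambda>: "cmod (\<Lambda> k) < 1" "1 - cmod (\<Lambda> k) \<le> t (r (k div 2))" "s (r (k div 2)) \<le> 1 - cmod (\<Lambda> k)" for k
    using interleave_cases[of "p \<circ> r" "q \<circ> r" k] p(1) q(1) by (auto simp: \<Lambda>_def t_def s_def)
  \<comment> \<open>The indices \<open>2 * n\<close> and \<open>2 * n + 1\<close> carry the \<open>n\<close>-th pair, so pairs are compared through \<open>k div 2\<close>.\<close>
  have later: "closeness (\<Lambda> i) (\<Lambda> k) \<le> 4 * (1 / 16) ^ (i div 2 - k div 2)" if "k div 2 < i div 2" for i k
  proof -
    have "1 - cmod (\<Lambda> i) \<le> s (r (k div 2)) * (1 / 16) ^ (i div 2 - k div 2)"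
      using \<Lambda>(2)[of i] geom[OF that] by linarith
    also have "\<dots> \<le> (1 - cmod (\<Lambda> k)) * (1 / 16) ^ (i div 2 - k div 2)"
      using \<Lambda>(3)[of k] by (intro mult_right_mono) auto
    finally have "(1 - cmod (\<Lambda> i)) / (1 - cmod (\<Lambda> k)) \<le> (1 / 16) ^ (i div 2 - k div 2)"
      using \<Lambda>(1)[of k] by (simp add: pos_divide_le_eq mult.commute)
    then show ?thesis using closeness_le_of_nearer_boundary[OF \<Lambda>(1) \<Lambda>(1), of i k] by linarith
  qed
  have pairs: "closeness (\<Lambda> i) (\<Lambda> k) \<le> 4 * (1 / 16) ^ nat \<bar>int (i div 2) - int (k div 2)\<bar>" for i k
  proof -
    consider "k div 2 < i div 2" | "i div 2 < k div 2" | "i div 2 = k div 2" by linarith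
    then show ?thesis
    proof cases
      case 1
      then have "nat \<bar>int (i div 2) - int (k div 2)\<bar> = i div 2 - k div 2" by linarith
      then show ?thesis using later[OF 1] by simp
    next
      case 2
      then have "nat \<bar>int (i div 2) - int (k div 2)\<bar> = k div 2 - i div 2" by linarith
      then show ?thesis using later[OF 2] by (simp add: closeness_commute)
    next
      case 3
      then show ?thesis using closeness_le_1[of "\<Lambda> i" "\<Lambda> k"] by simp
    qed
  qed
  have decay: "closeness (\<Lambda> i) (\<Lambda> k) \<le> 16 * (1 / 4) ^ nat \<bar>int i - int k\<bar>" for i k
  proof -
    let ?d = "nat \<bar>int (i div 2) - int (k div 2)\<bar>"
    have "nat \<bar>int i - int k\<bar> \<le> Suc (2 * ?d)" by linarith
    then have "(1 / 4 :: real) ^ Suc (2 * ?d) \<le> (1 / 4) ^ nat \<bar>int i - int k\<bar>"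
      by (intro power_decreasing) auto
    moreover have "(1 / 4 :: real) ^ Suc (2 * ?d) = (1 / 16) ^ ?d / 4"
      by (simp add: power_mult power2_eq_square)
    ultimately show ?thesis using pairs[of i k] by linarith
  qed
  have "dispersed UNIV \<Lambda>"
    unfolding dispersed_def
  proof (intro conjI)
    show "\<Lambda> \<in> UNIV \<rightarrow> unit_disc" using \<Lambda>(1) by simp
    have "min \<epsilon> (1 / 2) \<le> rho (\<Lambda> i) (\<Lambda> k)" if "i \<noteq> k" for i k
    proof (cases "i div 2 = k div 2")
      case True
      then have "even i \<noteq> even k" using that by presburger
      then have "\<epsilon> \<le> rho (\<Lambda> i) (\<Lambda> k)"
        using True \<epsilon>(2)[of "r (k div 2)"] by (cases "even i") (auto simp: \<Lambda>_def interleave_def rho_commute)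
      then show ?thesis by simp
    next
      case False
      then have "nat \<bar>int (i div 2) - int (k div 2)\<bar> \<ge> 1" by linarith
      then have "(1 / 16 :: real) ^ nat \<bar>int (i div 2) - int (k div 2)\<bar> \<le> (1 / 16) ^ 1"
        by (intro power_decreasing) auto
      then have "closeness (\<Lambda> i) (\<Lambda> k) \<le> 1 / 4" using pairs[of i k] by simp
      then have "(1 / 2)\<^sup>2 \<le> (rho (\<Lambda> i) (\<Lambda> k))\<^sup>2" by (simp add: rho_square power2_eq_square[of "1 / 2"])
      then have "1 / 2 \<le> rho (\<Lambda> i) (\<Lambda> k)" by (rule power2_le_imp_le) (rule rho_nonneg)
      then show ?thesis by simp
    qed
    moreover have "0 < min \<epsilon> (1 / 2)" using \<epsilon> by simp
    ultimately show "\<exists>\<epsilon>>0. \<forall>j\<in>UNIV. \<forall>k\<in>UNIV. j \<noteq> k \<longrightarrow> \<epsilon> \<le> rho (\<Lambda> j) (\<Lambda> k)" by blast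
    have "(\<Sum>j\<in>J. closeness (\<Lambda> j) (\<Lambda> k)) \<le> 16 * (2 / (1 - 1 / 4))" if "finite J" for J k
    proof -
      have "(\<Sum>j\<in>J. closeness (\<Lambda> j) (\<Lambda> k)) \<le> (\<Sum>j\<in>J. 16 * (1 / 4) ^ nat \<bar>int j - int k\<bar>)"
        by (rule sum_mono) (rule decay)
      also have "\<dots> = 16 * (\<Sum>j\<in>J. (1 / 4) ^ nat \<bar>int j - int k\<bar>)" by (simp add: sum_distrib_left)
      also have "\<dots> \<le> 16 * (2 / (1 - 1 / 4))"
        using that by (intro mult_left_mono sum_power_dist_le) auto
      finally show ?thesis .
    qed
    then show "\<exists>C. \<forall>k\<in>UNIV. \<forall>J\<subseteq>UNIV. finite J \<longrightarrow> (\<Sum>j\<in>J. closeness (\<Lambda> j) (\<Lambda> k)) \<le> C" by blast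
  qed
  then show thesis using that[OF mono] by (simp add: \<Lambda>_def carleson_sequence_iff_dispersed)
qed

section \<open>Reflecting Carleson sequences forces uniform continuity\<close>

text \<open>
  On a compact set \<open>F\<close> is uniformly continuous, so asymptotic pairs with images far apart cannot stay in one.
\<close>

lemma eventually_not_in_compact:
  assumes F: "\<And>z. cmod z < 1 \<Longrightarrow> cmod (F z) < 1" and cont: "continuous_on unit_disc F"
    and z: "\<And>n. cmod (z n) < 1" and w: "\<And>n. cmod (w n) < 1"
    and lim: "(\<lambda>n. rho (z n) (w n)) \<longlonglongrightarrow> 0"
    and \<epsilon>: "0 < \<epsilon>" "\<And>n. \<epsilon> \<le> rho (F (z n)) (F (w n))"
    and K: "compact K" "K \<subseteq> unit_disc"
  shows "\<forall>\<^sub>F n in sequentially. z n \<notin> K"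
proof (rule ccontr)
  assume "\<not> ?thesis"
  then have "infinite {n. z n \<in> K}"
    by (simp add: not_eventually frequently_sequentially infinite_nat_iff_unbounded_le)
  then obtain r :: "nat \<Rightarrow> nat" where r: "strict_mono r" "\<And>n. r n \<in> {n. z n \<in> K}"
    using infinite_enumerate by blast
  then obtain l s where l: "l \<in> K" and s: "strict_mono (s :: nat \<Rightarrow> nat)"
    and zl: "((\<lambda>n. z (r n)) \<circ> s) \<longlonglongrightarrow> l"
    using K(1) unfolding compact_def by (metis (mono_tags, lifting) mem_Collect_eq)
  define u where "u = r \<circ> s"
  have u: "strict_mono u" using r(1) s by (simp add: u_def strict_mono_o)
  have zu: "(\<lambda>n. z (u n)) \<longlonglongrightarrow> l" using zl by (simp add: u_def o_def)
  have l1: "cmod l < 1" using l K(2) by auto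
  have "(\<lambda>n. 2 * rho (z (u n)) (w (u n))) \<longlonglongrightarrow> 2 * 0"
    using LIMSEQ_subseq_LIMSEQ[OF lim u] by (intro tendsto_intros) (simp add: o_def)
  then have lim2: "(\<lambda>n. 2 * rho (z (u n)) (w (u n))) \<longlonglongrightarrow> 0" by simp
  have "(\<lambda>n. z (u n) - w (u n)) \<longlonglongrightarrow> 0"
  proof (rule Lim_null_comparison[OF _ lim2])
    show "\<forall>\<^sub>F n in sequentially. cmod (z (u n) - w (u n)) \<le> 2 * rho (z (u n)) (w (u n))"
    proof (intro always_eventually allI)
      fix n
      have "rho (z (u n)) (w (u n)) * cmod (1 - cnj (z (u n)) * w (u n)) \<le> rho (z (u n)) (w (u n)) * 2"
        by (rule mult_left_mono[OF cmod_one_minus_cnj_mult_le_2[OF z w] rho_nonneg])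
      then show "cmod (z (u n) - w (u n)) \<le> 2 * rho (z (u n)) (w (u n))"
        by (simp add: cmod_diff_le_rho[OF z w])
    qed
  qed
  then have "(\<lambda>n. z (u n) - (z (u n) - w (u n))) \<longlonglongrightarrow> l - 0"
    by (intro tendsto_diff zu)
  then have wu: "(\<lambda>n. w (u n)) \<longlonglongrightarrow> l" by simp
  have "isCont F l" using cont l1 continuous_on_eq_continuous_at[of unit_disc F] by simp
  then have Fz: "(\<lambda>n. F (z (u n))) \<longlonglongrightarrow> F l" and Fw: "(\<lambda>n. F (w (u n))) \<longlonglongrightarrow> F l"
    using zu wu isCont_tendsto_compose by blast+
  have "(\<lambda>n. rho (F (z (u n))) (F (w (u n)))) \<longlonglongrightarrow> rho (F l) (F l)"
    unfolding rho_def using one_minus_cnj_mult_nonzero[OF F[OF l1] F[OF l1]]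
    by (intro tendsto_intros Fz Fw)
  then have "\<epsilon> \<le> rho (F l) (F l)"
    by (rule LIMSEQ_le_const) (use \<epsilon> in auto)
  then show False using \<epsilon> by simp
qed

text \<open>
  If \<open>z n\<close> and \<open>w n\<close> were asymptotic while their images stay apart, the images of suitably sparse
  pairs would form a Carleson sequence; the pairs themselves never do, since Carleson
  sequences are separated.
\<close>

lemma rho_uniformly_continuous_of_reflects_carleson:
  assumes hom: "homeomorphism unit_disc unit_disc F G"
    and reflects: "\<And>\<Lambda>. \<Lambda> \<in> UNIV \<rightarrow> unit_disc \<Longrightarrow> carleson_sequence UNIV (\<lambda>j. F (\<Lambda> j)) \<Longrightarrow>
      carleson_sequence UNIV \<Lambda>"
  shows "uniformly_continuous_map rho_metric rho_metric F"
proof -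
  have cont: "continuous_on unit_disc F" "continuous_on unit_disc G"
    using hom by (auto simp: homeomorphism_def)
  have F: "cmod (F z) < 1" and G: "cmod (G z) < 1" and GF: "G (F z) = z" if "cmod z < 1" for z
    using hom that unfolding homeomorphism_def by (auto simp: image_subset_iff)
  have "\<exists>\<delta>>0. \<forall>x\<in>unit_disc. \<forall>y\<in>unit_disc. rho y x < \<delta> \<longrightarrow> rho (F y) (F x) < \<epsilon>" if \<epsilon>: "0 < \<epsilon>" for \<epsilon>
  proof (rule ccontr)
    assume neg: "\<not> ?thesis"
    have "\<exists>x y. cmod x < 1 \<and> cmod y < 1 \<and> rho y x < 1 / real (Suc n) \<and> \<epsilon> \<le> rho (F y) (F x)" for n
    proof -
      have "0 < 1 / real (Suc n)" by simp
      then show ?thesis using neg by (meson mem_ball_0 not_le)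
    qed
    then obtain w z where w: "\<And>n. cmod (w n) < 1" and z: "\<And>n. cmod (z n) < 1"
      and small: "\<And>n. rho (z n) (w n) < 1 / real (Suc n)" and big: "\<And>n. \<epsilon> \<le> rho (F (z n)) (F (w n))"
      by metis
    have lim: "(\<lambda>n. rho (z n) (w n)) \<longlonglongrightarrow> 0"
    proof (rule tendsto_sandwich[OF _ _ tendsto_const])
      show "(\<lambda>n. 1 / real (Suc n)) \<longlonglongrightarrow> 0" using LIMSEQ_inverse_real_of_nat by (simp add: inverse_eq_divide)
    qed (use small rho_nonneg in \<open>auto intro!: always_eventually less_imp_le\<close>)
    have big': "\<epsilon> \<le> rho (F (w n)) (F (z n))" for n using big by (simp add: rho_commute)
    have lim': "(\<lambda>n. rho (w n) (z n)) \<longlonglongrightarrow> 0" using lim by (simp add: rho_commute)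
    have escape: "(\<lambda>n. cmod (F (x n))) \<longlonglongrightarrow> 1"
      if x: "\<And>n. cmod (x n) < 1"
        and ev: "\<And>K. compact K \<Longrightarrow> K \<subseteq> unit_disc \<Longrightarrow> \<forall>\<^sub>F n in sequentially. x n \<notin> K" for x
    proof (rule order_tendstoI)
      fix a :: real assume a: "a < 1"
      have sub: "cball 0 a \<subseteq> unit_disc" using a by auto
      have "compact (G ` cball 0 a)"
        using continuous_on_subset[OF cont(2) sub] by (intro compact_continuous_image) auto
      moreover have "G ` cball 0 a \<subseteq> unit_disc" using G a by auto
      ultimately have "\<forall>\<^sub>F n in sequentially. x n \<notin> G ` cball 0 a" by (rule ev)
      then show "\<forall>\<^sub>F n in sequentially. a < cmod (F (x n))"
      proof eventually_elim
        case (elim n)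
        then have "F (x n) \<notin> cball 0 a" using GF[OF x[of n]] by (metis imageI)
        then show ?case by simp
      qed
    next
      fix a :: real assume "1 < a"
      then show "\<forall>\<^sub>F n in sequentially. cmod (F (x n)) < a"
        using F[OF x] by (intro always_eventually allI) (meson less_trans)
    qed
    have "(\<lambda>n. cmod (F (z n))) \<longlonglongrightarrow> 1"
      by (rule escape[OF z]) (rule eventually_not_in_compact[OF F cont(1) z w lim \<epsilon> big])
    moreover have "(\<lambda>n. cmod (F (w n))) \<longlonglongrightarrow> 1"
      by (rule escape[OF w]) (rule eventually_not_in_compact[OF F cont(1) w z lim' \<epsilon> big'])
    ultimately obtain r :: "nat \<Rightarrow> nat" where r: "strict_mono r"
      and carl: "carleson_sequence UNIV (interleave ((\<lambda>n. F (z n)) \<circ> r) ((\<lambda>n. F (w n)) \<circ> r))"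
      using sparse_subsequence_carleson[of "\<lambda>n. F (z n)" "\<lambda>n. F (w n)" \<epsilon>] F z w \<epsilon> big by blast
    define \<Lambda> where "\<Lambda> = interleave (z \<circ> r) (w \<circ> r)"
    have "interleave ((\<lambda>n. F (z n)) \<circ> r) ((\<lambda>n. F (w n)) \<circ> r) = (\<lambda>j. F (\<Lambda> j))"
      by (auto simp: \<Lambda>_def interleave_def)
    moreover have "\<Lambda> \<in> UNIV \<rightarrow> unit_disc"
      using z w by (auto simp: \<Lambda>_def interleave_def)
    ultimately have "dispersed UNIV \<Lambda>"
      using reflects[of \<Lambda>] carl carleson_sequence_imp_dispersed by simp
    then obtain \<sigma> where \<sigma>: "0 < \<sigma>" "\<And>j k. j \<noteq> k \<Longrightarrow> \<sigma> \<le> rho (\<Lambda> j) (\<Lambda> k)"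
      unfolding dispersed_def by (elim conjE exE) simp
    obtain n where n: "1 / real (Suc n) < \<sigma>" using nat_approx_posE[OF \<sigma>(1)] by blast
    have "\<sigma> \<le> rho (\<Lambda> (2 * n)) (\<Lambda> (Suc (2 * n)))" by (rule \<sigma>(2)) simp
    also have "\<dots> = rho (z (r n)) (w (r n))" by (simp add: \<Lambda>_def interleave_def)
    also have "\<dots> < 1 / real (Suc (r n))" by (rule small)
    also have "\<dots> \<le> 1 / real (Suc n)"
      using strict_mono_imp_increasing[OF r, of n] by (intro divide_left_mono) auto
    finally show False using n by simp
  qed
  then show ?thesis
    unfolding uniformly_continuous_map_def using F by (simp add: Pi_iff)
qed


section \<open>Carleson sequences under bounded displacement\<close>

lemma closeness_image_le:
  assumes F: "\<And>z. cmod z < 1 \<Longrightarrow> cmod (F z) < 1"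
    and \<eta>: "0 < \<eta>" "\<And>z. cmod z < 1 \<Longrightarrow> \<eta> \<le> closeness (F z) z"
    and z: "cmod z < 1" and w: "cmod w < 1"
  shows "closeness (F z) (F w) \<le> 16 / \<eta>\<^sup>2 * closeness z w"
proof -
  have c: "0 \<le> closeness (F z) (F w)" using closeness_nonneg F z w by blast
  have "\<eta> * closeness (F z) (F w) \<le> closeness z (F z) * closeness (F z) (F w)"
    using \<eta>(2)[OF z] c by (intro mult_right_mono) (simp_all add: closeness_commute)
  then have 1: "\<eta> * closeness (F z) (F w) / 4 \<le> closeness z (F w)"
    using closeness_triangle[OF z F[OF z] F[OF w]] by linarith
  have "\<eta> * closeness (F z) (F w) / 4 * \<eta> \<le> closeness z (F w) * closeness (F w) w"
    using 1 \<eta>(2)[OF w] \<eta>(1) c closeness_nonneg[OF z F[OF w]] by (intro mult_mono) auto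
  then have "\<eta> * closeness (F z) (F w) / 4 * \<eta> / 4 \<le> closeness z w"
    using closeness_triangle[OF z F[OF w] w] by linarith
  then show ?thesis using \<eta>(1) by (simp add: field_simps power2_eq_square)
qed

text \<open>
  Bounded displacement controls the closeness sums, and the lower modulus keeps the images separated.
\<close>

lemma carleson_sequence_image:
  assumes F: "\<And>z. cmod z < 1 \<Longrightarrow> cmod (F z) < 1"
    and \<eta>: "0 < \<eta>" "\<And>z. cmod z < 1 \<Longrightarrow> \<eta> \<le> closeness (F z) z"
    and low: "\<And>\<epsilon>. 0 < \<epsilon> \<Longrightarrow>
      \<exists>\<delta>>0. \<forall>z w. cmod z < 1 \<and> cmod w < 1 \<and> \<epsilon> \<le> rho z w \<longrightarrow> \<delta> \<le> rho (F z) (F w)"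
    and carl: "carleson_sequence I \<Lambda>"
  shows "carleson_sequence I (\<lambda>j. F (\<Lambda> j))"
proof -
  obtain \<epsilon> C where \<Lambda>: "\<Lambda> \<in> I \<rightarrow> unit_disc" and \<epsilon>: "\<epsilon> > 0"
    and sep: "\<forall>j\<in>I. \<forall>k\<in>I. j \<noteq> k \<longrightarrow> \<epsilon> \<le> rho (\<Lambda> j) (\<Lambda> k)"
    and sum: "\<forall>k\<in>I. \<forall>J\<subseteq>I. finite J \<longrightarrow> (\<Sum>j\<in>J. closeness (\<Lambda> j) (\<Lambda> k)) \<le> C"
    using carleson_sequence_imp_dispersed[OF carl] unfolding dispersed_def
    by (elim conjE exE) (rule that; assumption)
  have \<Lambda>1: "cmod (\<Lambda> j) < 1" if "j \<in> I" for j using \<Lambda> that by auto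
  obtain \<delta> where \<delta>: "0 < \<delta>"
    "\<And>z w. cmod z < 1 \<Longrightarrow> cmod w < 1 \<Longrightarrow> \<epsilon> \<le> rho z w \<Longrightarrow> \<delta> \<le> rho (F z) (F w)"
    using low[OF \<epsilon>] by blast
  have "dispersed I (\<lambda>j. F (\<Lambda> j))"
    unfolding dispersed_def
  proof (intro conjI)
    show "(\<lambda>j. F (\<Lambda> j)) \<in> I \<rightarrow> unit_disc" using F \<Lambda>1 by simp
    have "\<delta> \<le> rho (F (\<Lambda> j)) (F (\<Lambda> k))" if "j \<in> I" "k \<in> I" "j \<noteq> k" for j k
      using \<delta>(2) \<Lambda>1 sep that by simp
    then show "\<exists>\<epsilon>>0. \<forall>j\<in>I. \<forall>k\<in>I. j \<noteq> k \<longrightarrow> \<epsilon> \<le> rho (F (\<Lambda> j)) (F (\<Lambda> k))" using \<delta>(1) by blast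
    have "(\<Sum>j\<in>J. closeness (F (\<Lambda> j)) (F (\<Lambda> k))) \<le> 16 / \<eta>\<^sup>2 * C"
      if k: "k \<in> I" and J: "J \<subseteq> I" "finite J" for J k
    proof -
      have "(\<Sum>j\<in>J. closeness (F (\<Lambda> j)) (F (\<Lambda> k))) \<le> (\<Sum>j\<in>J. 16 / \<eta>\<^sup>2 * closeness (\<Lambda> j) (\<Lambda> k))"
        using J \<Lambda>1 k by (intro sum_mono closeness_image_le[OF F \<eta>]) auto
      also have "\<dots> = 16 / \<eta>\<^sup>2 * (\<Sum>j\<in>J. closeness (\<Lambda> j) (\<Lambda> k))"
        by (rule sum_distrib_left[symmetric])
      also have "\<dots> \<le> 16 / \<eta>\<^sup>2 * C"
        using sum k J by (intro mult_left_mono) auto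
      finally show ?thesis .
    qed
    then show "\<exists>C. \<forall>k\<in>I. \<forall>J\<subseteq>I. finite J \<longrightarrow> (\<Sum>j\<in>J. closeness (F (\<Lambda> j)) (F (\<Lambda> k))) \<le> C" by blast
  qed
  then show ?thesis by (rule dispersed_imp_carleson_sequence)
qed

lemma one_minus_cmod_square_comparable:
  assumes F: "cmod w < 1" and z: "cmod z < 1" and \<eta>: "\<eta> \<le> closeness w z"
  shows "\<eta> / 4 * (1 - (cmod z)\<^sup>2) \<le> 1 - (cmod w)\<^sup>2"
proof -
  have "\<eta> * closeness z 0 \<le> closeness w z * closeness z 0"
    using \<eta> closeness_nonneg[OF z, of 0] by (intro mult_right_mono) auto
  then show ?thesis
    using closeness_triangle[OF F z, of 0] by (simp add: closeness_0)
qed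

section \<open>Uniformity and the moduli of distortion\<close>

lemma rho_uniformly_continuous_iff:
  "uniformly_continuous_map rho_metric rho_metric F \<longleftrightarrow>
     F \<in> unit_disc \<rightarrow> unit_disc \<and>
     (\<forall>\<epsilon>>0. \<exists>\<delta>>0. \<forall>z w. cmod z < 1 \<and> cmod w < 1 \<and> rho z w < \<delta> \<longrightarrow> rho (F z) (F w) < \<epsilon>)"
  unfolding uniformly_continuous_map_def pseudohyperbolic.mspace_metric pseudohyperbolic.mdist_metric
    Ball_def mem_ball_0 by (simp add: imp_conjL) meson

lemma rho_uniformly_continuousD:
  assumes "uniformly_continuous_map rho_metric rho_metric F" "0 < \<epsilon>"
  obtains \<delta> where "0 < \<delta>" "\<And>z w. cmod z < 1 \<Longrightarrow> cmod w < 1 \<Longrightarrow> rho z w < \<delta> \<Longrightarrow> rho (F z) (F w) < \<epsilon>"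
  using assms unfolding rho_uniformly_continuous_iff by meson

lemma rho_set_bounds:
  assumes F: "F \<in> unit_disc \<rightarrow> unit_disc"
  shows "bdd_above {rho (F z) (F w) | z w. z \<in> unit_disc \<and> w \<in> unit_disc \<and> P z w}"
    and "bdd_below {rho (F z) (F w) | z w. z \<in> unit_disc \<and> w \<in> unit_disc \<and> P z w}"
proof -
  have "rho (F z) (F w) \<le> 1" if "z \<in> unit_disc" "w \<in> unit_disc" for z w
    using rho_lt_1[of "F z" "F w"] F that by (fastforce simp: Pi_iff)
  then show "bdd_above {rho (F z) (F w) | z w. z \<in> unit_disc \<and> w \<in> unit_disc \<and> P z w}"
    by (intro bdd_aboveI[of _ 1]) blast
  show "bdd_below {rho (F z) (F w) | z w. z \<in> unit_disc \<and> w \<in> unit_disc \<and> P z w}"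
    using rho_nonneg by (intro bdd_belowI[of _ 0]) blast
qed

lemma omega_tendsto_0_iff:
  assumes F: "F \<in> unit_disc \<rightarrow> unit_disc"
  shows "(omega F \<longlongrightarrow> 0) (at_right 0) \<longleftrightarrow> uniformly_continuous_map rho_metric rho_metric F"
proof
  assume lim: "(omega F \<longlongrightarrow> 0) (at_right 0)"
  have "\<exists>\<delta>>0. \<forall>z w. cmod z < 1 \<and> cmod w < 1 \<and> rho z w < \<delta> \<longrightarrow> rho (F z) (F w) < \<epsilon>" if "0 < \<epsilon>" for \<epsilon>
  proof -
    have "\<forall>\<^sub>F t in at_right 0. omega F t < \<epsilon>" by (rule order_tendstoD(2)[OF lim that])
    then obtain b where b: "0 < b" "\<And>t. 0 < t \<Longrightarrow> t < b \<Longrightarrow> omega F t < \<epsilon>"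
      unfolding eventually_at_right_field by blast
    have "rho (F z) (F w) < \<epsilon>" if "cmod z < 1" "cmod w < 1" "rho z w < b / 2" for z w
    proof -
      have "rho (F z) (F w) \<le> omega F (b / 2)"
        unfolding omega_def using that
        by (intro cSup_upper rho_set_bounds[OF F] CollectI exI[of _ z] exI[of _ w]) auto
      also have "\<dots> < \<epsilon>" using b by simp
      finally show ?thesis .
    qed
    then show ?thesis using b(1) half_gt_zero by blast
  qed
  then show "uniformly_continuous_map rho_metric rho_metric F"
    using F unfolding rho_uniformly_continuous_iff by blast
next
  assume uc: "uniformly_continuous_map rho_metric rho_metric F"
  show "(omega F \<longlongrightarrow> 0) (at_right 0)"
  proof (rule tendstoI)
    fix \<epsilon> :: real assume \<epsilon>: "0 < \<epsilon>"
    then have e2: "0 < \<epsilon> / 2" by simp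
    obtain \<delta> where \<delta>: "0 < \<delta>" "\<And>z w. cmod z < 1 \<Longrightarrow> cmod w < 1 \<Longrightarrow> rho z w < \<delta> \<Longrightarrow> rho (F z) (F w) < \<epsilon> / 2"
      using rho_uniformly_continuousD[OF uc e2] by blast
    have "dist (omega F t) 0 < \<epsilon>" if t: "0 < t" "t < \<delta>" for t
    proof -
      have mem: "rho (F 0) (F 0) \<in> {rho (F z) (F w) | z w. z \<in> unit_disc \<and> w \<in> unit_disc \<and> rho z w \<le> t}"
        using t by (intro CollectI exI[of _ 0]) auto
      have "0 \<le> omega F t"
        unfolding omega_def using cSup_upper[OF mem rho_set_bounds(1)[OF F]] by simp
      moreover have "omega F t \<le> \<epsilon> / 2"
        unfolding omega_def
      proof (rule cSup_least)
        fix x assume "x \<in> {rho (F z) (F w) | z w. z \<in> unit_disc \<and> w \<in> unit_disc \<and> rho z w \<le> t}"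
        then obtain z w where "x = rho (F z) (F w)" "cmod z < 1" "cmod w < 1" "rho z w \<le> t" by auto
        then show "x \<le> \<epsilon> / 2" using \<delta>(2)[of z w] t by simp
      qed (use mem in blast)
      ultimately show ?thesis using \<epsilon> by simp
    qed
    then show "\<forall>\<^sub>F t in at_right 0. dist (omega F t) 0 < \<epsilon>"
      unfolding eventually_at_right_field using \<delta>(1) by blast
  qed
qed

lemma ell_pos_iff:
  assumes hom: "homeomorphism unit_disc unit_disc F G"
  shows "(\<forall>t. 0 < t \<and> t < 1 \<longrightarrow> ell F t > 0) \<longleftrightarrow> uniformly_continuous_map rho_metric rho_metric G"
proof -
  have F: "F \<in> unit_disc \<rightarrow> unit_disc" and G: "G \<in> unit_disc \<rightarrow> unit_disc"
    using hom by (auto simp: homeomorphism_def)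
  have GF: "G (F z) = z" and FG: "F (G z) = z" if "cmod z < 1" for z
    using hom that by (auto simp: homeomorphism_def)
  show ?thesis
  proof
    assume pos: "\<forall>t. 0 < t \<and> t < 1 \<longrightarrow> ell F t > 0"
    have "\<exists>\<delta>>0. \<forall>z w. cmod z < 1 \<and> cmod w < 1 \<and> rho z w < \<delta> \<longrightarrow> rho (G z) (G w) < \<epsilon>" if \<epsilon>: "0 < \<epsilon>" for \<epsilon>
    proof -
      define t where "t = min \<epsilon> (1 / 2)"
      have t: "0 < t" "t < 1" "t \<le> \<epsilon>" using \<epsilon> by (auto simp: t_def)
      have "rho (G z) (G w) < \<epsilon>" if z: "cmod z < 1" and w: "cmod w < 1" and lt: "rho z w < ell F t" for z w
      proof (rule ccontr)
        assume "\<not> rho (G z) (G w) < \<epsilon>"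
        then have ge: "t \<le> rho (G z) (G w)" using t by simp
        have Gz: "G z \<in> unit_disc" "G w \<in> unit_disc" using G z w by (auto simp: Pi_iff)
        have "ell F t \<le> rho (F (G z)) (F (G w))"
          unfolding ell_def using ge Gz by (intro cInf_lower rho_set_bounds[OF F]) blast
        then show False using lt FG[OF z] FG[OF w] by simp
      qed
      then show ?thesis using pos t by blast
    qed
    then show "uniformly_continuous_map rho_metric rho_metric G"
      using G unfolding rho_uniformly_continuous_iff by blast
  next
    assume uc: "uniformly_continuous_map rho_metric rho_metric G"
    show "\<forall>t. 0 < t \<and> t < 1 \<longrightarrow> ell F t > 0"
    proof (intro allI impI)
      fix t :: real assume t: "0 < t \<and> t < 1"
      obtain \<delta> where \<delta>: "0 < \<delta>" "\<And>z w. cmod z < 1 \<Longrightarrow> cmod w < 1 \<Longrightarrow> rho z w < \<delta> \<Longrightarrow> rho (G z) (G w) < t"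
        using rho_uniformly_continuousD[OF uc, of t] t by blast
      have "\<delta> \<le> ell F t"
        unfolding ell_def
      proof (rule cInf_greatest)
        have "rho 0 (of_real t) = t" using t by (simp add: rho_def)
        then have "rho (F 0) (F (of_real t)) \<in>
            {rho (F z) (F w) | z w. z \<in> unit_disc \<and> w \<in> unit_disc \<and> t \<le> rho z w}"
          using t by (intro CollectI exI[of _ 0] exI[of _ "of_real t"]) auto
        then show "{rho (F z) (F w) | z w. z \<in> unit_disc \<and> w \<in> unit_disc \<and> t \<le> rho z w} \<noteq> {}" by blast
      next
        fix x assume "x \<in> {rho (F z) (F w) | z w. z \<in> unit_disc \<and> w \<in> unit_disc \<and> t \<le> rho z w}"
        then obtain z w where x: "x = rho (F z) (F w)" and z: "cmod z < 1" and w: "cmod w < 1" and ge: "t \<le> rho z w"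
          by auto
        have "cmod (F z) < 1" "cmod (F w) < 1" using F z w by (auto simp: Pi_iff)
        then show "\<delta> \<le> x" using \<delta>(2)[of "F z" "F w"] GF[OF z] GF[OF w] ge x by force
      qed
      then show "ell F t > 0" using \<delta>(1) by simp
    qed
  qed
qed


section \<open>The three characterisations\<close>

lemma homeomorphism_discD:
  assumes "homeomorphism unit_disc unit_disc F G" "cmod z < 1"
  shows "cmod (F z) < 1" "cmod (G z) < 1" "G (F z) = z" "F (G z) = z"
  using assms by (auto simp: homeomorphism_def)

lemma rho_uniform_homeomorphism_displacement:
  assumes hom: "homeomorphism unit_disc unit_disc F G"
    and ucF: "uniformly_continuous_map rho_metric rho_metric F"
    and ucG: "uniformly_continuous_map rho_metric rho_metric G"
    and bv: "identity_boundary_values F"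
  obtains \<eta> where "0 < \<eta>" "\<And>z. cmod z < 1 \<Longrightarrow> \<eta> \<le> closeness (F z) z"
proof -
  have half: "(0::real) < 1 / 2" by simp
  obtain a where a: "0 < a" "\<And>z w. cmod z < 1 \<Longrightarrow> cmod w < 1 \<Longrightarrow> rho z w < a \<Longrightarrow> rho (F z) (F w) < 1 / 2"
    using rho_uniformly_continuousD[OF ucF half] by blast
  obtain b where b: "0 < b" "\<And>z w. cmod z < 1 \<Longrightarrow> cmod w < 1 \<Longrightarrow> rho z w < b \<Longrightarrow> rho (G z) (G w) < 1 / 2"
    using rho_uniformly_continuousD[OF ucG half] by blast
  define \<delta> where "\<delta> = min (1 / 2) (min a b / 2)"
  have \<delta>: "0 < \<delta>" "\<delta> < 1" "\<delta> < a" "\<delta> < b" using a(1) b(1) by (auto simp: \<delta>_def min_def)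
  have stepF: "rho (F z) (F w) \<le> 1 / 2" if "cmod z < 1" "cmod w < 1" "rho z w \<le> \<delta>" for z w
    using a(2)[of z w] that \<delta> by simp
  have stepG: "rho (G z) (G w) \<le> 1 / 2" if "cmod z < 1" "cmod w < 1" "rho z w \<le> \<delta>" for z w
    using b(2)[of z w] that \<delta> by simp
  note D = homeomorphism_discD[OF hom]
  show thesis
  proof (rule bounded_displacement[of F G \<delta>])
    show "cmod (F z) < 1" "cmod (G z) < 1" "G (F z) = z" if "cmod z < 1" for z
      using D[OF that] by simp_all
  qed (rule \<delta>(1,2) bv stepF stepG that; assumption)+
qed

lemma rho_lower_modulus:
  assumes hom: "homeomorphism unit_disc unit_disc F G"
    and ucG: "uniformly_continuous_map rho_metric rho_metric G" and \<epsilon>: "0 < \<epsilon>"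
  shows "\<exists>\<delta>>0. \<forall>z w. cmod z < 1 \<and> cmod w < 1 \<and> \<epsilon> \<le> rho z w \<longrightarrow> \<delta> \<le> rho (F z) (F w)"
proof -
  obtain \<delta> where \<delta>: "0 < \<delta>" "\<And>z w. cmod z < 1 \<Longrightarrow> cmod w < 1 \<Longrightarrow> rho z w < \<delta> \<Longrightarrow> rho (G z) (G w) < \<epsilon>"
    using rho_uniformly_continuousD[OF ucG \<epsilon>] by blast
  have "\<delta> \<le> rho (F z) (F w)" if "cmod z < 1" "cmod w < 1" "\<epsilon> \<le> rho z w" for z w
    using \<delta>(2)[of "F z" "F w"] homeomorphism_discD[OF hom that(1)] homeomorphism_discD[OF hom that(2)] that(3)
    by force
  then show ?thesis using \<delta>(1) by blast
qed

lemma displacement_inverse: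
  assumes "homeomorphism unit_disc unit_disc F G" "\<And>z. cmod z < 1 \<Longrightarrow> \<eta> \<le> closeness (F z) z" "cmod w < 1"
  shows "\<eta> \<le> closeness (G w) w"
  using assms(2)[OF homeomorphism_discD(2)[OF assms(1,3)]]
  unfolding homeomorphism_discD(4)[OF assms(1,3)] closeness_commute[of w] .

lemma identity_boundary_values_of_displacement:
  assumes hom: "homeomorphism unit_disc unit_disc F G"
    and \<eta>: "0 < \<eta>" "\<And>z. cmod z < 1 \<Longrightarrow> \<eta> \<le> closeness (F z) z"
  shows "identity_boundary_values F" "is_boundary_map F id"
proof -
  note D = homeomorphism_discD[OF hom]
  have hom': "homeomorphism unit_disc unit_disc G F" by (rule homeomorphism_sym[THEN iffD1, OF hom])
  have cont: "continuous_on unit_disc F" "continuous_on unit_disc G"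
    using hom by (auto simp: homeomorphism_def)
  define E where "E z = (if cmod z < 1 then F z else z)" for z
  define E' where "E' z = (if cmod z < 1 then G z else z)" for z
  have cE: "continuous_on (cball 0 1) E"
    unfolding E_def by (rule continuous_on_extend_by_id[OF D(1) cont(1) \<eta>])
  have cE': "continuous_on (cball 0 1) E'"
    unfolding E'_def
    by (rule continuous_on_extend_by_id[OF D(2) cont(2) \<eta>(1) displacement_inverse[OF hom \<eta>(2)]])
  show "identity_boundary_values F"
    unfolding identity_boundary_values_def using cE by (intro exI[of _ E]) (auto simp: E_def)
  have "homeomorphism (cball 0 1) (cball 0 1) E E'"
    using D by (intro homeomorphismI cE cE') (auto simp: E_def E'_def less_imp_le)
  then show "is_boundary_map F id"
    unfolding is_boundary_map_def by (intro exI[of _ E] exI[of _ E']) (auto simp: E_def)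
qed

lemma carleson_sequence_cong:
  assumes "\<And>j. j \<in> I \<Longrightarrow> \<Lambda> j = \<Lambda>' j"
  shows "carleson_sequence I \<Lambda> \<longleftrightarrow> carleson_sequence I \<Lambda>'"
  unfolding carleson_sequence_def Pi_iff using assms by (simp cong: ball_cong)

lemma in_K_c_of_displacement:
  assumes hom: "homeomorphism unit_disc unit_disc F G"
    and ucF: "uniformly_continuous_map rho_metric rho_metric F"
    and ucG: "uniformly_continuous_map rho_metric rho_metric G"
    and \<eta>: "0 < \<eta>" "\<And>z. cmod z < 1 \<Longrightarrow> \<eta> \<le> closeness (F z) z"
  shows "F \<in> K_c"
proof -
  note D = homeomorphism_discD[OF hom]
  have hom': "homeomorphism unit_disc unit_disc G F" by (rule homeomorphism_sym[THEN iffD1, OF hom])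
  have "carleson_sequence I \<Lambda> \<longleftrightarrow> carleson_sequence I (\<lambda>j. F (\<Lambda> j))" if \<Lambda>: "\<Lambda> \<in> I \<rightarrow> unit_disc" for I \<Lambda>
  proof
    assume carl: "carleson_sequence I \<Lambda>"
    show "carleson_sequence I (\<lambda>j. F (\<Lambda> j))"
    proof (rule carleson_sequence_image[of F \<eta> I \<Lambda>])
      show "cmod (F z) < 1" "\<eta> \<le> closeness (F z) z" if "cmod z < 1" for z
        using D(1) \<eta>(2) that by blast+
    qed (rule \<eta>(1) carl rho_lower_modulus[OF hom ucG]; assumption?)+
  next
    assume carl: "carleson_sequence I (\<lambda>j. F (\<Lambda> j))"
    have "carleson_sequence I (\<lambda>j. G (F (\<Lambda> j)))"
    proof (rule carleson_sequence_image[of G \<eta> I "\<lambda>j. F (\<Lambda> j)"])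
      show "cmod (G z) < 1" "\<eta> \<le> closeness (G z) z" if "cmod z < 1" for z
        using D(2)[OF that] displacement_inverse[OF hom \<eta>(2) that] by blast+
    qed (rule \<eta>(1) carl rho_lower_modulus[OF hom' ucF]; assumption?)+
    moreover have "G (F (\<Lambda> j)) = \<Lambda> j" if "j \<in> I" for j
      using D(3)[of "\<Lambda> j"] funcset_mem[OF \<Lambda> that] by simp
    ultimately show "carleson_sequence I \<Lambda>" using carleson_sequence_cong[of I "\<lambda>j. G (F (\<Lambda> j))" \<Lambda>] by simp
  qed
  moreover have "continuous_on unit_disc F" "F \<in> unit_disc \<rightarrow> unit_disc"
    using hom by (auto simp: homeomorphism_def)
  ultimately have maps: "F \<in> carleson_equivalence_maps"
    unfolding carleson_equivalence_maps_def by blast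
  have comparable: "\<exists>c C. 0 < c \<and> c \<le> C \<and> (\<forall>z\<in>unit_disc. c * (1 - (cmod z)\<^sup>2) \<le> 1 - (cmod (F z))\<^sup>2 \<and>
      1 - (cmod (F z))\<^sup>2 \<le> C * (1 - (cmod z)\<^sup>2))"
  proof (rule exI[of _ "\<eta> / 4"], rule exI[of _ "4 / \<eta>"], intro conjI ballI)
    show "0 < \<eta> / 4" using \<eta> by simp
    have "\<eta> \<le> 1" using \<eta>(2)[of 0] closeness_le_1[of "F 0" 0] by simp
    then have "\<eta> * \<eta> \<le> 1 * 1" using \<eta>(1) by (intro mult_mono) auto
    then show "\<eta> / 4 \<le> 4 / \<eta>" using \<eta>(1) by (simp add: field_simps)
  next
    fix z assume "z \<in> unit_disc"
    then have z: "cmod z < 1" by simp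
    show "\<eta> / 4 * (1 - (cmod z)\<^sup>2) \<le> 1 - (cmod (F z))\<^sup>2"
      by (rule one_minus_cmod_square_comparable[OF D(1)[OF z] z \<eta>(2)[OF z]])
    have "\<eta> / 4 * (1 - (cmod (F z))\<^sup>2) \<le> 1 - (cmod z)\<^sup>2"
      using \<eta>(2)[OF z] by (intro one_minus_cmod_square_comparable z D(1)[OF z]) (simp add: closeness_commute)
    then show "1 - (cmod (F z))\<^sup>2 \<le> 4 / \<eta> * (1 - (cmod z)\<^sup>2)" using \<eta>(1) by (simp add: field_simps)
  qed
  show ?thesis
    unfolding K_c_def P_c_def mem_Collect_eq
    by (intro conjI maps comparable identity_boundary_values_of_displacement(2)[OF hom \<eta>])
qed

text \<open>
  An extension to the closed disc that fixes the circle pointwise maps the open disc onto itself. Both the map and its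
  inverse then reflect Carleson sequences.
\<close>

lemma K_c_imp_rho_uniform_homeomorphism:
  assumes map: "F \<in> unit_disc \<rightarrow> unit_disc" and K: "F \<in> K_c"
  shows "rho_uniform_homeomorphism F \<and> identity_boundary_values F"
proof -
  have bm: "is_boundary_map F id" and F: "F \<in> carleson_equivalence_maps"
    using K by (auto simp: K_c_def P_c_def)
  obtain E E' where E: "homeomorphism (cball 0 1) (cball 0 1) E E'"
    "\<And>z. cmod z < 1 \<Longrightarrow> E z = F z" "\<And>\<zeta>. cmod \<zeta> = 1 \<Longrightarrow> E \<zeta> = \<zeta>"
    using bm unfolding is_boundary_map_def by auto
  have E': "E' (E z) = z" "E (E' z) = z" "cmod (E' z) \<le> 1" if "cmod z \<le> 1" for z
    using E(1) that by (auto simp: homeomorphism_def)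
  have contE: "continuous_on (cball 0 1) E" "continuous_on (cball 0 1) E'"
    using E(1) by (auto simp: homeomorphism_def)
  have Fd: "cmod (F z) < 1" if "cmod z < 1" for z using map that by auto
  have E'd: "cmod (E' w) < 1" if w: "cmod w < 1" for w
  proof (rule ccontr)
    assume "\<not> cmod (E' w) < 1"
    then have "cmod (E' w) = 1" using E'(3)[of w] w by simp
    then have "E' w = w" using E(3) E'(2)[of w] w by simp
    then show False using \<open>cmod (E' w) = 1\<close> w by simp
  qed
  have hom: "homeomorphism unit_disc unit_disc F E'"
  proof (rule homeomorphismI)
    show "continuous_on unit_disc F" using F by (simp add: carleson_equivalence_maps_def)
    show "continuous_on unit_disc E'" by (rule continuous_on_subset[OF contE(2)]) auto
    show "E' (F z) = z" if "z \<in> unit_disc" for z using E'(1)[of z] E(2)[of z] that by simp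
    show "F (E' w) = w" if "w \<in> unit_disc" for w using E'(2)[of w] E(2)[OF E'd] that by simp
  qed (use Fd E'd in auto)
  have hom': "homeomorphism unit_disc unit_disc E' F" by (rule homeomorphism_sym[THEN iffD1, OF hom])
  have equiv: "carleson_sequence I \<Lambda> \<longleftrightarrow> carleson_sequence I (\<lambda>j. F (\<Lambda> j))" if "\<Lambda> \<in> I \<rightarrow> unit_disc" for I \<Lambda>
    using F that by (simp add: carleson_equivalence_maps_def)
  have "uniformly_continuous_map rho_metric rho_metric F"
    using equiv by (intro rho_uniformly_continuous_of_reflects_carleson[OF hom]) blast
  moreover have "uniformly_continuous_map rho_metric rho_metric E'"
  proof (rule rho_uniformly_continuous_of_reflects_carleson[OF hom'])
    fix \<Lambda> :: "nat \<Rightarrow> complex"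
    assume \<Lambda>: "\<Lambda> \<in> UNIV \<rightarrow> unit_disc" and "carleson_sequence UNIV (\<lambda>j. E' (\<Lambda> j))"
    then have "carleson_sequence UNIV (\<lambda>j. F (E' (\<Lambda> j)))"
      using equiv[of "\<lambda>j. E' (\<Lambda> j)" UNIV] E'd by (simp add: Pi_iff)
    then show "carleson_sequence UNIV \<Lambda>"
      using homeomorphism_discD(4)[OF hom] \<Lambda> by (simp add: Pi_iff)
  qed
  moreover have "identity_boundary_values F"
    unfolding identity_boundary_values_def using contE(1) E(2,3) by (intro exI[of _ E]) auto
  ultimately show ?thesis unfolding rho_uniform_homeomorphism_def using hom by blast
qed

theorem theorem3p3:
  fixes \<Psi> :: "complex \<Rightarrow> complex"
  assumes "\<Psi> \<in> unit_disc \<rightarrow> unit_disc"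
  shows
    "(\<Psi> \<in> K_c \<longleftrightarrow> rho_uniform_homeomorphism \<Psi> \<and> identity_boundary_values \<Psi>) \<and>
     (rho_uniform_homeomorphism \<Psi> \<and> identity_boundary_values \<Psi> \<longleftrightarrow>
       (\<exists>G. homeomorphism unit_disc unit_disc \<Psi> G) \<and>
       (SUP z\<in>unit_disc. rho (\<Psi> z) z) < 1 \<and>
       (omega \<Psi> \<longlongrightarrow> 0) (at_right 0) \<and>
       (\<forall>t. 0 < t \<and> t < 1 \<longrightarrow> ell \<Psi> t > 0))"
    (is "(_ \<longleftrightarrow> ?unif \<and> ?id) \<and> (_ \<longleftrightarrow> ?hom \<and> ?sup \<and> ?omega \<and> ?ell)")
proof -
  have i: "\<Psi> \<in> K_c" and iii: "?hom \<and> ?sup \<and> ?omega \<and> ?ell" if ii: "?unif \<and> ?id"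
  proof -
    obtain G where hom: "homeomorphism unit_disc unit_disc \<Psi> G"
      and ucF: "uniformly_continuous_map rho_metric rho_metric \<Psi>"
      and ucG: "uniformly_continuous_map rho_metric rho_metric G"
      using ii unfolding rho_uniform_homeomorphism_def by blast
    obtain \<eta> where \<eta>: "0 < \<eta>" "\<And>z. cmod z < 1 \<Longrightarrow> \<eta> \<le> closeness (\<Psi> z) z"
      using rho_uniform_homeomorphism_displacement[OF hom ucF ucG] ii by blast
    show "\<Psi> \<in> K_c" by (rule in_K_c_of_displacement[OF hom ucF ucG \<eta>])
    have "(SUP z\<in>unit_disc. rho (\<Psi> z) z) \<le> sqrt (1 - \<eta>)"
      using \<eta> closeness_ge_imp_rho_le by (intro cSUP_least) auto
    also have "\<dots> < 1" using \<eta>(1) by simp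
    finally have ?sup .
    then show "?hom \<and> ?sup \<and> ?omega \<and> ?ell"
      using hom ucF ucG omega_tendsto_0_iff[OF assms] ell_pos_iff[OF hom] by blast
  qed
  have ii: "?unif \<and> ?id" if iii: "?hom \<and> ?sup \<and> ?omega \<and> ?ell"
  proof -
    obtain G where hom: "homeomorphism unit_disc unit_disc \<Psi> G" using iii by blast
    define r where "r = (SUP z\<in>unit_disc. rho (\<Psi> z) z)"
    have "bdd_above ((\<lambda>z. rho (\<Psi> z) z) ` unit_disc)"
      using rho_lt_1 homeomorphism_discD(1)[OF hom] by (intro bdd_aboveI2[of _ _ 1]) (auto intro: less_imp_le)
    then have le: "rho (\<Psi> z) z \<le> r" if "cmod z < 1" for z
      unfolding r_def using that by (intro cSUP_upper) auto
    have "0 \<le> r" using order_trans[OF rho_nonneg le[of 0]] by simp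
    moreover have "r < 1" using iii by (simp add: r_def)
    ultimately have r: "0 \<le> r" "r < 1" .
    have \<eta>: "0 < 1 - r\<^sup>2" "\<And>z. cmod z < 1 \<Longrightarrow> 1 - r\<^sup>2 \<le> closeness (\<Psi> z) z"
      using r le rho_nonneg by (auto simp: closeness_def abs_square_less_1 power_mono)
    have "?unif"
      unfolding rho_uniform_homeomorphism_def
      using iii hom omega_tendsto_0_iff[OF assms] ell_pos_iff[OF hom] by blast
    then show ?thesis using identity_boundary_values_of_displacement(1)[OF hom \<eta>] by blast
  qed
  show ?thesis using i iii ii K_c_imp_rho_uniform_homeomorphism[OF assms] by blast
qed

end
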